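(* For every $n>0$ there is a triangulation $T$ of the torus with $n \leq |V(T)|$ such that $T$ has a non-degenerated antiferromagnetic groundstate.
   Context: A triangulation of a closed surface is an embedding of a graph in the surface such that each face boundary is a $3$-cycle of the graph. A state (spin-assignment) on a triangulation $T$ is a function $\sigma: V(T)\to\{+1,-1\}$. The antiferromagnetic Ising energy of $\sigma$ is $H(\sigma)=\sum_{uv\in E(T)}\sigma_u\sigma_v$. A groundstate is a state minimizing $H$. Since $H(\sigma)=H(-\sigma)$, groundstates come in pairs $\{\sigma,-\sigma\}$; the groundstate is called non-degenerated if $T$ has exactly two groundstates (i.e. exactly one pair $\sigma,-\sigma$), and degenerated if it has more than two. *)

theory Defs
  imports "HOL-Analysis.Analysis"
begin

definition torus :: "(complex \<times> complex) set" where
  "torus = sphere 0 1 \<times> sphere 0 1"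

definition simple_graph :: "'v set \<Rightarrow> 'v set set \<Rightarrow> bool" where
  "simple_graph V E \<longleftrightarrow> finite V \<and> (\<forall>e\<in>E. e \<subseteq> V \<and> card e = 2)"

definition graph_embedding ::
    "'a::topological_space set \<Rightarrow> 'v set \<Rightarrow> 'v set set \<Rightarrow> ('v \<Rightarrow> 'a) \<Rightarrow> ('v set \<Rightarrow> real \<Rightarrow> 'a) \<Rightarrow> bool" where
  "graph_embedding S V E \<phi> \<gamma> \<longleftrightarrow>
     inj_on \<phi> V \<and> \<phi> ` V \<subseteq> S \<and>
     (\<forall>e\<in>E. arc (\<gamma> e) \<and> path_image (\<gamma> e) \<subseteq> S \<and>
            {pathstart (\<gamma> e), pathfinish (\<gamma> e)} = \<phi> ` e \<and>
            path_image (\<gamma> e) \<inter> \<phi> ` V = \<phi> ` e) \<and>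
     (\<forall>e\<in>E. \<forall>f\<in>E. e \<noteq> f \<longrightarrow> path_image (\<gamma> e) \<inter> path_image (\<gamma> f) = \<phi> ` (e \<inter> f))"

definition faces ::
    "'a::topological_space set \<Rightarrow> 'v set \<Rightarrow> 'v set set \<Rightarrow> ('v \<Rightarrow> 'a) \<Rightarrow> ('v set \<Rightarrow> real \<Rightarrow> 'a) \<Rightarrow> 'a set set" where
  "faces S V E \<phi> \<gamma> = components (S - (\<phi> ` V \<union> (\<Union>e\<in>E. path_image (\<gamma> e))))"

text \<open>Faces are required to be open discs, as is standard for embeddings in closed surfaces.
  The boundary condition alone would also admit, for instance, a planar triangulation drawn inside
  a disc of the torus, whose outer face is a punctured torus bounded by a 3-cycle.\<close>

definition triangulation_of ::
    "'a::topological_space set \<Rightarrow> 'v set \<Rightarrow> 'v set set \<Rightarrow> ('v \<Rightarrow> 'a) \<Rightarrow> ('v set \<Rightarrow> real \<Rightarrow> 'a) \<Rightarrow> bool" where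
  "triangulation_of S V E \<phi> \<gamma> \<longleftrightarrow>
     simple_graph V E \<and> graph_embedding S V E \<phi> \<gamma> \<and>
     (\<forall>F \<in> faces S V E \<phi> \<gamma>.
        F homeomorphic ball (0::complex) 1 \<and>
        (\<exists>u v w. distinct [u, v, w] \<and> {{u, v}, {v, w}, {w, u}} \<subseteq> E \<and>
           top_of_set S frontier_of F =
             path_image (\<gamma> {u, v}) \<union> path_image (\<gamma> {v, w}) \<union> path_image (\<gamma> {w, u})))"

definition states :: "'v set \<Rightarrow> ('v \<Rightarrow> int) set" where
  "states V = V \<rightarrow>\<^sub>E {1, -1}"

text \<open>An edge is a set of two vertices, so the product is that of the spins at its two ends.\<close>

definition energy :: "'v set set \<Rightarrow> ('v \<Rightarrow> int) \<Rightarrow> int" where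
  "energy E \<sigma> = (\<Sum>e\<in>E. \<Prod>v\<in>e. \<sigma> v)"

definition groundstates :: "'v set \<Rightarrow> 'v set set \<Rightarrow> ('v \<Rightarrow> int) set" where
  "groundstates V E = {\<sigma> \<in> states V. \<forall>\<tau> \<in> states V. energy E \<sigma> \<le> energy E \<tau>}"

definition nondegenerated_groundstate :: "'v set \<Rightarrow> 'v set set \<Rightarrow> bool" where
  "nondegenerated_groundstate V E \<longleftrightarrow> card (groundstates V E) = 2"

end

theory Submission imports Defs begin

text \<open>
  Every face has at least one monochromatic edge, so the energy is at least minus half the number of
  faces, with equality exactly for the spin assignments without monochromatic face. It therefore
  suffices to find arbitrarily large triangulations of the torus whose vertices can be 2-coloured
  without monochromatic face in just one way up to exchanging the colours.

  Start from a suitable triangulation on nine vertices and subdivide an edge \<open>uv\<close> with opposite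
  vertices \<open>b\<close> and \<open>c\<close> into a path with an odd number of edges, joining
      all new vertices to \<open>b\<close>
  and \<open>c\<close>. The faces away from the path already force \<open>b\<close> and \<open>c\<close> to differ (here \<open>b\<close> and \<open>c\<close> are
  the vertices 5 and 7, and the path runs from 3 through 8, 9, \<dots> to the last vertex); then the colours
  alternate along the path, and the colouring is determined by that of the original triangulation.

  To embed these graphs, the vertices are stacked in three vertical columns of the flat torus, the
  \<open>t\<close>-th vertex at height \<open>t\<close>, and each vertex is joined by straight
      segments to the vertices that are
  topmost in the three columns when it is added.
\<close>

section \<open>Cell decompositions and the flat torus\<close>

text \<open>Two obstacles shape the construction: no two vertices may be joined twice, and the faces
  have to be identified as discs. For the faces, the triangles are written down in the plane
  covering the torus, as regions between consecutive graphs of affine functions over a strip; a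
  finite clopen argument then takes the place of the Jordan curve theorem. Placing vertex
  \<open>t\<close> cuts off two triangles, one on each side of the segment from its predecessor in
  the column up to \<open>t\<close>. With three columns the neighbouring columns on the two sides
  are distinct, and a column with three vertices per period has no doubled vertical edge; hence the
  starting size nine. Appending further vertices to the third column leaves the tops 5 and 7 of the
  other two in place until the period closes up, and this is the subdivision of the path. The energy
  part works with explicit lists of edges and face terms; the two parts meet in the edge set
  computed by \<open>word_edges\<close>.\<close>

lemma components_cell_decomposition:
  fixes S G :: "'a::t2_space set" and O' C B :: "'i \<Rightarrow> 'a set"
  assumes fin: "finite I" and S: "S = (\<Union>i\<in>I. C i)" and G: "closed G"
    and C: "\<And>i. i \<in> I \<Longrightarrow> compact (C i)" "\<And>i. i \<in> I
        \<Longrightarrow> C i = O' i \<union> B i"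
      "\<And>i. i \<in> I \<Longrightarrow> C i \<subseteq> closure (O' i)"
    and B: "\<And>i. i \<in> I \<Longrightarrow> B i \<subseteq> G"
    and O': "\<And>i. i \<in> I \<Longrightarrow> O' i \<inter> G = {}" "\<And>i. i \<in> I
        \<Longrightarrow> connected (O' i)"
      "\<And>i. i \<in> I \<Longrightarrow> O' i \<noteq> {}"
      "\<And>i k. i \<in> I \<Longrightarrow> k \<in> I \<Longrightarrow> O' i \<inter> O' k
          \<noteq> {} \<Longrightarrow> O' i = O' k"
  shows "components (S - G) = O' ` I"
    and "\<And>i. i \<in> I \<Longrightarrow> top_of_set S frontier_of O' i = B i"
proof -
  have SG: "S - G = (\<Union>i\<in>I. O' i)"
    using S C(2) B O'(1) by blast
  have cl: "closedin (top_of_set (S - G)) (O' i)" if "i \<in> I" for i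
  proof -
    \<comment> \<open>The rest \<open>B i\<close> of the cell lies in \<open>G\<close>, so removing
      \<open>G\<close> leaves exactly \<open>O' i\<close>, which is therefore relatively
      closed.\<close>
    have "O' i = (S - G) \<inter> C i"
      using that S C(2) B O'(1) by blast
    then show ?thesis
      using C(1)[OF that] compact_imp_closed closedin_closed by blast
  qed
  have op: "openin (top_of_set (S - G)) (O' i)" if i: "i \<in> I" for i
  proof -
    \<comment> \<open>By finiteness the other cells together form a closed set, so their complement
      \<open>O' i\<close> is also open. Cells equal to \<open>O' i\<close> as sets are skipped,
      which allows the index family to repeat a cell.\<close>
    have "closedin (top_of_set (S - G)) (\<Union>k\<in>{k\<in>I. O' k \<noteq> O' i}. O' k)"
      using fin cl by (intro closedin_Union) auto
    moreover have "(S - G) - (\<Union>k\<in>{k\<in>I. O' k \<noteq> O' i}. O' k) = O' i"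
      unfolding SG using O'(4) i by blast
    ultimately show ?thesis
      by (metis openin_diff openin_subtopology_self)
  qed
  have comp: "O' i \<in> components (S - G)" if i: "i \<in> I" for i
    unfolding in_components_maximal
  proof (intro conjI allI impI)
    show "O' i \<noteq> {}" "connected (O' i)" "O' i \<subseteq> S - G"
      using i O' SG by auto
    fix D assume D: "D \<noteq> {} \<and> O' i \<subseteq> D \<and> D \<subseteq> S - G \<and> connected D"
    have "openin (top_of_set D) (O' i)" "closedin (top_of_set D) (O' i)"
      using D op[OF i] cl[OF i] by (meson openin_subset_trans closedin_subset_trans)+
    then show "D = O' i"
      using D \<open>O' i \<noteq> {}\<close> unfolding connected_clopen by metis
  qed
  show "components (S - G) = O' ` I"
  proof (intro equalityI subsetI)
    fix X assume X: "X \<in> components (S - G)"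
    then obtain x where "x \<in> X" "x \<in> S - G"
      using in_components_nonempty in_components_subset by fastforce
    then obtain i where i: "i \<in> I" "x \<in> O' i"
      using SG by auto
    then have "X = O' i"
      using components_nonoverlap[OF X comp[OF i(1)]] \<open>x \<in> X\<close> by blast
    then show "X \<in> O' ` I"
      using i by blast
  qed (use comp in auto)
  fix i assume i: "i \<in> I"
  have "openin (top_of_set S) (S - G)"
    using G by (simp add: openin_diff openin_open_Int Diff_eq open_Compl)
  then have o: "openin (top_of_set S) (O' i)"
    using op[OF i] openin_trans by blast
  have "closure (O' i) = C i"
    using C[OF i] by (metis Un_upper1 closure_minimal compact_imp_closed subset_antisym)
  moreover have "O' i \<subseteq> S" "C i \<subseteq> S"
    using i C(2) S by auto
  ultimately have "top_of_set S closure_of O' i = C i"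
    by (simp add: closure_of_subtopology Int_absorb1)
  then have "top_of_set S frontier_of O' i = C i - O' i"
    using o by (simp add: frontier_of_def interior_of_openin)
  then show "top_of_set S frontier_of O' i = B i"
    using C(2)[OF i] B[OF i] O'(1)[OF i] by blast
qed

text \<open>A continuous injection of a compact set into a Hausdorff space is a homeomorphism onto
  its image, and so are its restrictions. Injectivity of the covering map on a closed triangle thus
  transfers the topology of the open triangle to the torus.\<close>

lemma homeomorphic_inj_image_of_compact:
  fixes f :: "'a::topological_space \<Rightarrow> 'b::t2_space"
  assumes "compact K" "continuous_on K f" "inj_on f K" "U \<subseteq> K"
  shows "f ` U homeomorphic U"
proof -
  obtain g where "homeomorphism K (f ` K) f g"
    using homeomorphism_compact assms by blast
  then have "homeomorphism U (f ` U) f g"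
    using assms(4) homeomorphism_of_subsets by blast
  then show ?thesis
    using homeomorphic_def homeomorphic_sym by blast
qed

section \<open>The torus as a quotient of the plane by the periods \<open>a\<close> and
  \<open>b\<close>\<close>

definition torus_cover :: "real \<Rightarrow> real \<Rightarrow> real \<times> real \<Rightarrow>
    complex \<times> complex" where
  "torus_cover a b = (\<lambda>(x, y). (cis (2 * pi * x / a), cis (2 * pi * y / b)))"

lemma cis_eq_cis_iff: "cis x = cis y \<longleftrightarrow> (\<exists>k::int. x = y + 2 * pi * k)"
  using sin_cos_eq_iff[of x y] by (auto simp: complex_eq_iff)

lemma cis_period_eq_iff:
  fixes a x y :: real
  assumes "a > 0"
  shows "cis (2 * pi * x / a) = cis (2 * pi * y / a) \<longleftrightarrow> (\<exists>k::int. x = y + a * k)"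
proof -
  have "2 * pi * x / a = 2 * pi * y / a + 2 * pi * k \<longleftrightarrow> x = y + a * k" for k :: real
  proof -
    have "2 * pi * x / a = 2 * pi * y / a + 2 * pi * k \<longleftrightarrow> (2 * pi) * (x / a) =
        (2 * pi) * (y / a + k)"
      by (simp add: algebra_simps)
    also have "\<dots> \<longleftrightarrow> x / a = y / a + k"
      by (subst mult_cancel_left) simp
    also have "\<dots> \<longleftrightarrow> x = y + a * k"
      using assms by (simp add: field_simps)
    finally show ?thesis .
  qed
  then show ?thesis
    unfolding cis_eq_cis_iff by simp
qed

lemma torus_cover_eq_iff:
  assumes "a > 0" "b > 0"
  shows "torus_cover a b (x, y) = torus_cover a b (x', y')
    \<longleftrightarrow> (\<exists>(k::int) (l::int). x = x' + a * k \<and> y = y' + b * l)"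
  using assms by (simp add: torus_cover_def cis_period_eq_iff)

lemma continuous_on_torus_cover [continuous_intros]: "continuous_on A (torus_cover a b)"
  unfolding torus_cover_def case_prod_unfold divide_inverse by (intro continuous_intros)

lemma range_torus_cover:
  assumes "a > 0" "b > 0"
  shows "range (torus_cover a b) = torus"
proof (intro equalityI subsetI)
  fix z assume "z \<in> torus"
  then obtain u v where z: "z = (u, v)" "norm u = 1" "norm v = 1"
    by (auto simp: torus_def)
  then have "u = cis (2 * pi * (a * Arg u / (2 * pi)) / a)" "v = cis (2 * pi * (b * Arg v / (2 * pi)) / b)"
    using assms rcis_cmod_Arg[of u] rcis_cmod_Arg[of v] by (simp_all add: rcis_def)
  then show "z \<in> range (torus_cover a b)"
    unfolding z(1) torus_cover_def by (metis (no_types, lifting) case_prod_conv rangeI)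
qed (auto simp: torus_def torus_cover_def)

text \<open>Rescaling each vertical section affinely to the unit interval maps the region to an open
  square, and square, plane and disc are homeomorphic. The inequality concerns interior
  \<open>x\<close> only, because the two graphs bounding a triangle meet over one side of the
  strip.\<close>

lemma homeomorphic_region_between_affine:
  fixes p a b c d :: real
  defines "U \<equiv> {(x, y). p < x \<and> x < p + 1 \<and> a + b * (x - p) < y \<and> y < c + d *
      (x - p)}"
  assumes less: "\<And>x. p < x \<Longrightarrow> x < p + 1 \<Longrightarrow> a + b * (x - p) < c +
      d * (x - p)"
  shows "U homeomorphic ball (0::complex) 1"
proof -
  let ?B = "box (p, 0) (p + 1, 1) :: (real \<times> real) set"
  let ?l = "\<lambda>x. a + b * (x - p)" and ?u = "\<lambda>x. c + d * (x - p)"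
  have B: "?B = {(x, y). p < x \<and> x < p + 1 \<and> 0 < y \<and> y < 1}"
    by (auto simp: box_def Basis_prod_def)
  define f where "f = (\<lambda>(x, y). (x, (y - ?l x) / (?u x - ?l x)))"
  define g where "g = (\<lambda>(x, y). (x, ?l x + y * (?u x - ?l x)))"
  have f: "f z \<in> ?B" "g (f z) = z" if z: "z \<in> U" for z
  proof -
    obtain x y where xy: "z = (x, y)" "p < x" "x < p + 1" "?l x < y" "y < ?u x"
      using z unfolding U_def by auto
    define D where "D = ?u x - ?l x"
    have D: "D > 0" "y - ?l x < D"
      using xy by (simp_all add: D_def)
    then show "f z \<in> ?B" "g (f z) = z"
      using xy D unfolding B xy(1) f_def g_def prod.case D_def[symmetric] by simp_all
  qed
  have g: "g z \<in> U" "f (g z) = z" if z: "z \<in> ?B" for z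
  proof -
    obtain x y where xy: "z = (x, y)" "p < x" "x < p + 1" "0 < y" "y < 1"
      using z unfolding B by auto
    define D where "D = ?u x - ?l x"
    have "D > 0"
      using less[of x] xy by (simp add: D_def)
    then have "0 < y * D" "y * D < D"
      using xy by auto
    then show "g z \<in> U"
      using xy unfolding U_def xy(1) g_def D_def by auto
    show "f (g z) = z"
      using \<open>D > 0\<close> unfolding xy(1) f_def g_def D_def by simp
  qed
  have "homeomorphism U ?B f g"
    unfolding homeomorphism_def
  proof (intro conjI ballI f g)
    show "f ` U = ?B"
      using f(1) g by (force intro!: image_eqI[of _ f "g _"])
    show "g ` ?B = U"
      using f g(1) by (force intro!: image_eqI[of _ g "f _"])
    show "continuous_on U f"
      unfolding f_def case_prod_unfold
      by (intro continuous_intros) (use less in \<open>force simp: U_def\<close>)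
    show "continuous_on ?B g"
      unfolding g_def case_prod_unfold by (intro continuous_intros)
  qed
  moreover have "(p + 1/2, 1/2) \<in> ?B"
    by (simp add: B)
  then have "?B homeomorphic (UNIV :: (real \<times> real) set)"
    by (intro homeomorphic_box_UNIV) blast
  moreover have "(UNIV :: (real \<times> real) set) homeomorphic (UNIV :: complex set)"
    by (simp add: homeomorphic_UNIV_UNIV)
  moreover have "(UNIV :: complex set) homeomorphic ball (0::complex) 1"
    using homeomorphic_ball01_UNIV homeomorphic_sym by blast
  ultimately show ?thesis
    using homeomorphic_def homeomorphic_trans by metis
qed

text \<open>The inverse rescaling \<open>g\<close> extends to the closed square and maps it onto
  \<open>K\<close>, possibly collapsing a side to an apex. Continuity of \<open>g\<close> then puts
  \<open>K\<close> into the closure of the image of the open square.\<close>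

lemma closed_region_between_affine:
  fixes p a b c d :: real
  defines "U \<equiv> {(x, y). p < x \<and> x < p + 1 \<and> a + b * (x - p) < y \<and> y < c + d *
      (x - p)}"
    and "K \<equiv> {(x, y). p \<le> x \<and> x \<le> p + 1 \<and> a + b * (x - p) \<le> y \<and> y
        \<le> c + d * (x - p)}"
  assumes less: "\<And>x. p < x \<Longrightarrow> x < p + 1 \<Longrightarrow> a + b * (x - p) < c +
      d * (x - p)"
  shows "compact K" "K \<subseteq> closure U"
proof -
  let ?l = "\<lambda>x. a + b * (x - p)" and ?u = "\<lambda>x. c + d * (x - p)"
  define g where "g = (\<lambda>(x, y). (x, ?l x + y * (?u x - ?l x)))"
  let ?B = "box (p, 0) (p + 1, 1) :: (real \<times> real) set"
  let ?C = "cbox (p, 0) (p + 1, 1) :: (real \<times> real) set"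
  have B: "?B = {(x, y). p < x \<and> x < p + 1 \<and> 0 < y \<and> y < 1}"
    by (auto simp: box_def Basis_prod_def)
  have C: "?C = {(x, y). p \<le> x \<and> x \<le> p + 1 \<and> 0 \<le> y \<and> y \<le> 1}"
    by (auto simp: cbox_def Basis_prod_def)
  have cont: "continuous_on A g" for A
    unfolding g_def case_prod_unfold by (intro continuous_intros)
  have gB: "g z \<in> U" if z: "z \<in> ?B" for z
  proof -
    obtain x y where xy: "z = (x, y)" "p < x" "x < p + 1" "0 < y" "y < 1"
      using z unfolding B by auto
    define D where "D = ?u x - ?l x"
    have "D > 0"
      using less[of x] xy by (simp add: D_def)
    then have "0 < y * D" "y * D < D"
      using xy by auto
    then show ?thesis
      using xy unfolding U_def xy(1) g_def D_def by auto
  qed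
  have KC: "K \<subseteq> g ` ?C"
  proof
    fix z assume "z \<in> K"
    then obtain x y where xy: "z = (x, y)" "p \<le> x" "x \<le> p + 1" "?l x \<le> y" "y \<le> ?u x"
      unfolding K_def by auto
    define D where "D = ?u x - ?l x"
    have D: "D \<ge> 0" "y - ?l x \<le> D" "y - ?l x \<ge> 0"
      using xy by (simp_all add: D_def)
    have "(x, (y - ?l x) / D) \<in> ?C"
      using xy D unfolding C by (auto simp: divide_le_eq_1)
    \<comment> \<open>At an apex \<open>D = 0\<close>; division by zero yields the parameter 0,
      which is a preimage since there \<open>y = ?l x\<close>.\<close>
    moreover have "z = g (x, (y - ?l x) / D)"
      using D unfolding xy(1) g_def prod.case D_def[symmetric] by (cases "D = 0") auto
    ultimately show "z \<in> g ` ?C"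
      by blast
  qed
  have "(p + 1/2, 1/2) \<in> ?B"
    by (simp add: B)
  then have "closure ?B = ?C"
    by (intro closure_box) blast
  then have "g ` ?C \<subseteq> closure (g ` ?B)"
    using cont by (metis closure_subset image_closure_subset closed_closure)
  then show "K \<subseteq> closure U"
    using KC gB closure_mono[of "g ` ?B" U] by blast
  have "closed K"
    unfolding K_def case_prod_unfold by (intro closed_Collect_conj closed_Collect_le continuous_intros)
  moreover have "bounded K"
    using KC bounded_subset compact_imp_bounded[OF compact_continuous_image[OF cont compact_cbox]] by blast
  ultimately show "compact K"
    by (simp add: compact_eq_bounded_closed)
qed

section \<open>Triangulations stacked in three columns\<close>

text \<open>Vertices are integers modulo \<open>n\<close>: the vertex \<open>t\<close> lies in column \<open>w t\<close> (columns are taken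
  modulo 3) at height \<open>t\<close>, and \<open>cur j t\<close> is the topmost vertex of column \<open>j\<close> of height at most \<open>t\<close>.
  The last two assumptions exclude multiple edges.\<close>

locale column_word =
  fixes n :: int and w :: "int \<Rightarrow> int" and cur :: "int \<Rightarrow> int \<Rightarrow> int"
  assumes n_pos: "0 < n"
    and w_range: "0 \<le> w t" "w t < 3"
    and w_period: "w (t + n * k) = w t"
    and cur_column: "cur (j + 3 * k) t = cur j t"
    and cur_period: "cur j (t + n * k) = cur j t + n * k"
    and cur_le: "cur j t \<le> t"
    and w_cur: "w (cur j t) = j mod 3"
    and cur_step: "cur j t = (if w t = j mod 3 then t else cur j (t - 1))"
    and cur_distinct: "cur j t = cur j t' \<Longrightarrow> cur k t' < cur k t + n"
    and prev_prev: "t - n < cur (w t) (cur (w t) (t - 1) - 1)"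
begin

text \<open>The strip between columns \<open>j\<close> and \<open>j + 1\<close> is cut into triangles by the graphs of
  \<open>height j t\<close>; consecutive graphs bound a triangle unless they coincide.\<close>

definition height :: "int \<Rightarrow> int \<Rightarrow> real \<Rightarrow> real" where
  "height j t x = real_of_int (cur j t) + (real_of_int (cur (j + 1) t) - real_of_int (cur j t)) * x"

abbreviation q :: "real \<Rightarrow> real \<Rightarrow> complex \<times> complex" where
  "q x y \<equiv> torus_cover 3 (real_of_int n) (x, y)"

definition prev :: "int \<Rightarrow> int" where "prev t = cur (w t) (t - 1)"
definition vtx :: "int \<Rightarrow> nat" where "vtx t = nat (t mod n)"
definition pos :: "nat \<Rightarrow> complex \<times> complex" where "pos v = q (w (int v)) (int v)"
definition V :: "nat set" where "V = {..<nat n}"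
definition slant :: "int \<Rightarrow> int \<Rightarrow> nat set" where
  "slant j t = {vtx (cur j t), vtx (cur (j + 1) t)}"
definition vert :: "int \<Rightarrow> nat set" where "vert t = {vtx t, vtx (prev t)}"
definition E :: "nat set set" where "E = range (case_prod slant) \<union> range vert"

definition slant_path :: "int \<Rightarrow> int \<Rightarrow> real \<Rightarrow> complex \<times>
    complex" where
  "slant_path j t = torus_cover 3 (real_of_int n) \<circ> linepath (real_of_int j, real_of_int (cur
      j t)) (real_of_int (j + 1), real_of_int (cur (j + 1) t))"
definition vert_path :: "int \<Rightarrow> real \<Rightarrow> complex \<times> complex" where
  "vert_path t = torus_cover 3 (real_of_int n) \<circ> linepath (real_of_int (w t), real_of_int
      (prev t)) (real_of_int (w t), real_of_int t)"
text \<open>The same edge arises from many pairs \<open>(j, t)\<close>: from all \<open>t\<close>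
  between two changes of its ends, and from all translates by a period. \<open>SOME\<close> picks
  one representation; \<open>path_image_edge_path_slant\<close> and
  \<open>path_image_edge_path_vert\<close> show that the image does not depend on it.\<close>

definition edge_path :: "nat set \<Rightarrow> real \<Rightarrow> complex \<times> complex" where
  "edge_path e = (SOME g. (\<exists>j t. e = slant j t \<and> g = slant_path j t) \<or>
      (\<exists>t. e = vert t \<and> g = vert_path t))"

section \<open>Order and periodicity of the vertices in a column\<close>

lemma q_eq_iff:
  "q x y = q x' y' \<longleftrightarrow> (\<exists>(k::int) (l::int). x = x' + 3 * real_of_int k
      \<and> y = y' + real_of_int n * real_of_int l)"
  using n_pos torus_cover_eq_iff[of 3 "real_of_int n"] by simp

lemma w_unique: "real_of_int (w t) = real_of_int (w t') + 3 * real_of_int k \<Longrightarrow> w t = w t'"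
proof -
  assume "real_of_int (w t) = real_of_int (w t') + 3 * real_of_int k"
  then have "real_of_int (w t) = real_of_int (w t' + 3 * k)"
    by simp
  then have "w t = w t' + 3 * k"
    by (simp only: of_int_eq_iff)
  then show ?thesis
    using w_range[of t] w_range[of t'] by presburger
qed

lemma cur_mod: "cur (j mod 3) t = cur j t"
  using cur_column[of "j mod 3" "j div 3" t] by simp

lemma cur_mono: "t \<le> t' \<Longrightarrow> cur j t \<le> cur j t'"
proof (induction t' rule: int_ge_induct)
  case (step t')
  then show ?case
    using cur_step[of j "t' + 1"] cur_le[of j t'] by (auto split: if_splits)
qed simp

lemma cur_self: "w t = j mod 3 \<Longrightarrow> cur j t = t"
  using cur_step by simp

lemma cur_other: "w t \<noteq> j mod 3 \<Longrightarrow> cur j t = cur j (t - 1)"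
  using cur_step[of j t] by simp

lemma w_mod: "w t mod 3 = w t"
  using w_range[of t] by simp

lemma cur_prev: "w t = j mod 3 \<Longrightarrow> cur j (t - 1) = prev t"
  unfolding prev_def using cur_mod[of j] by simp

lemma w_prev: "w (prev t) = w t"
  unfolding prev_def by (simp add: w_cur w_mod)

lemma prev_less: "prev t < t"
  unfolding prev_def using cur_le[of "w t" "t - 1"] by simp

lemma prev_prev_greater: "t - n < prev (prev t)"
  using prev_prev[of t] unfolding prev_def[of "prev t"] w_prev unfolding prev_def .

lemma prev_greater: "t - n < prev t"
  using prev_prev_greater[of t] prev_less[of "prev t"] by linarith

lemma prev_period: "prev (t + n * k) = prev t + n * k"
  unfolding prev_def w_period using cur_period[of "w t" "t - 1" k] by (simp add: algebra_simps)

lemma le_prev: "s < t \<Longrightarrow> w s = w t \<Longrightarrow> s \<le> prev t"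
  unfolding prev_def using cur_mono[of s "t - 1" "w t"] cur_self[of s "w t"] w_mod by simp

lemma vtx_eq_iff: "vtx s = vtx t \<longleftrightarrow> (\<exists>k. s = t + n * k)"
proof -
  have "vtx s = vtx t \<longleftrightarrow> s mod n = t mod n"
    unfolding vtx_def using n_pos by (simp add: nat_eq_iff)
  also have "\<dots> \<longleftrightarrow> (\<exists>k. s = t + n * k)"
    by (metis mod_mult_self2 mod_eqE)
  finally show ?thesis .
qed

lemma vtx_period: "vtx (t + n * k) = vtx t"
  using vtx_eq_iff by blast

lemma int_vtx: "\<exists>k. t = int (vtx t) + n * k"
  unfolding vtx_def using n_pos by (intro exI[of _ "t div n"]) simp

lemma w_vtx: "w (int (vtx t)) = w t"
  using int_vtx[of t] w_period by metis

lemma vtx_in_V: "vtx t \<in> V"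
  unfolding vtx_def V_def using n_pos by (simp add: nat_less_iff)

lemma vtx_eq_self: "v \<in> V \<Longrightarrow> vtx (int v) = v"
  unfolding vtx_def V_def by (simp add: zless_nat_eq_int_zless)

text \<open>Positions are defined through the least nonnegative representatives; periodicity of the
  cover makes every lift of a vertex, in every congruent column, give the same point.\<close>

lemma pos_vtx: "w t = j mod 3 \<Longrightarrow> pos (vtx t) = q j t"
proof -
  assume *: "w t = j mod 3"
  obtain k where k: "t = int (vtx t) + n * k"
    using int_vtx by blast
  have "real_of_int j = real_of_int (w t) + 3 * real_of_int (j div 3)"
    using * by (metis mod_mult_div_eq of_int_add of_int_mult of_int_numeral)
  moreover have "real_of_int t = real_of_int (int (vtx t)) + real_of_int n * real_of_int k"
    using k by (metis of_int_add of_int_mult)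
  ultimately have "q j t = q (w t) (int (vtx t))"
    unfolding q_eq_iff by blast
  then show ?thesis
    unfolding pos_def w_vtx by simp
qed

lemma inj_on_pos: "inj_on pos V"
proof (rule inj_onI)
  fix u v assume uv: "u \<in> V" "v \<in> V" "pos u = pos v"
  then obtain l :: int where "real_of_int (int u) = real_of_int (int v) + real_of_int n * real_of_int l"
    unfolding pos_def q_eq_iff by auto
  then have "int u = int v + n * l"
    by (metis of_int_add of_int_eq_iff of_int_mult)
  then have "vtx (int u) = vtx (int v)"
    using vtx_eq_iff by blast
  then show "u = v"
    using uv vtx_eq_self by simp
qed

section \<open>Slanted and vertical segments and their intersections\<close>

lemma height_mono: "t \<le> t' \<Longrightarrow> 0 \<le> x \<Longrightarrow> x \<le> 1
    \<Longrightarrow> height j t x \<le> height j t' x"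
proof -
  assume *: "t \<le> t'" "0 \<le> x" "x \<le> 1"
  have "(1 - x) * cur j t \<le> (1 - x) * cur j t'" "x * cur (j + 1) t \<le> x * cur (j + 1) t'"
    using * cur_mono by (auto intro!: mult_left_mono)
  then show ?thesis
    unfolding height_def by (simp add: algebra_simps)
qed

lemma height_period: "height j (t + n * k) x = height j t x + n * k"
  unfolding height_def cur_period by (simp add: algebra_simps)

lemma height_column: "height (j + 3 * k) t x = height j t x"
  using cur_column[of j k t] cur_column[of "j + 1" k t] unfolding height_def
  by (simp add: algebra_simps)

text \<open>The difference of two heights combines the differences at the two ends with weights
  \<open>1 - x\<close> and \<open>x\<close>. Both ends move monotonically with \<open>t\<close>, so
  over an interior point it vanishes only if both ends agree: two graphs over a strip never
  cross.\<close>

lemma height_inj_wlog: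
  assumes "height j t x = height j t' x" "0 < x" "x < 1" "t \<le> t'"
  shows "cur j t = cur j t' \<and> cur (j + 1) t = cur (j + 1) t'"
proof -
  have 1: "cur j t \<le> cur j t'" "cur (j + 1) t \<le> cur (j + 1) t'"
    using assms cur_mono by auto
  have "(1 - x) * (real_of_int (cur j t') - cur j t) + x * (real_of_int (cur (j + 1) t') - cur (j +
      1) t) = 0"
    using assms(1) unfolding height_def by (simp add: algebra_simps)
  moreover have "0 \<le> (1 - x) * (real_of_int (cur j t') - cur j t)" "0 \<le> x * (real_of_int
      (cur (j + 1) t') - cur (j + 1) t)"
    using 1 assms by auto
  ultimately have "(1 - x) * (real_of_int (cur j t') - cur j t) = 0" "x * (real_of_int (cur (j + 1)
      t') - cur (j + 1) t) = 0"
    by linarith+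
  then show ?thesis
    using assms by simp
qed

lemma height_inj:
  assumes "height j t x = height j t' x" "0 < x" "x < 1"
  shows "cur j t = cur j t' \<and> cur (j + 1) t = cur (j + 1) t'"
  using height_inj_wlog[of j t x t'] height_inj_wlog[of j t' x t] assms by (metis linear)

lemma column_coordinate_unique:
  fixes j j' k :: int and x x' :: real
  assumes "real_of_int j + x = real_of_int j' + x' + 3 * real_of_int k" "0 \<le> x" "x < 1" "0
      \<le> x'" "x' < 1"
  shows "j = j' + 3 * k" "x = x'"
proof -
  have "\<lfloor>j + x\<rfloor> = j" "\<lfloor>real_of_int (j' + 3 * k) + x'\<rfloor> = j' + 3 * k"
    using assms by linarith+
  moreover have "real_of_int j + x = real_of_int (j' + 3 * k) + x'"
    using assms(1) by simp
  ultimately show "j = j' + 3 * k"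
    by metis
  then show "x = x'"
    using assms(1) by simp
qed

text \<open>Equality of the segments in the plane up to the deck translation by
  \<open>(3 * k, n * l)\<close>. It mediates between equality of edges as vertex sets and
  coincidence of their images on the torus.\<close>

definition same_slant :: "int \<Rightarrow> int \<Rightarrow> int \<Rightarrow> int \<Rightarrow>
    bool" where
  "same_slant j t j' t' \<longleftrightarrow> (\<exists>k l. j = j' + 3 * k \<and> cur j t = cur j
      t' + n * l \<and> cur (j + 1) t = cur (j + 1) t' + n * l)"

lemma same_slant_if_meet:
  fixes x x' :: real
  assumes "q (j + x) (height j t x) = q (j' + x') (height j' t' x')" "0 < x" "x < 1" "0 < x'" "x' < 1"
  shows "same_slant j t j' t'"
proof -
  obtain k l :: int where kl: "real_of_int j + x = real_of_int j' + x' + 3 * real_of_int k"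
    "height j t x = height j' t' x' + real_of_int n * real_of_int l"
    using assms(1) unfolding q_eq_iff by blast
  have j: "j = j' + 3 * k" "x = x'"
    using column_coordinate_unique[OF kl(1)] assms by auto
  have "height j t x = height j (t' + n * l) x"
    using kl(2) j height_column height_period by simp
  then have "cur j t = cur j (t' + n * l) \<and> cur (j + 1) t = cur (j + 1) (t' + n * l)"
    using height_inj assms by blast
  then show ?thesis
    unfolding same_slant_def cur_period using j by blast
qed

text \<open>This excludes multiple slanted edges: segments with the same end vertices on the torus
  could a priori have their two ends shifted by different multiples of \<open>n\<close>.\<close>

lemma same_slant_if_eq:
  assumes "slant j t = slant j' t'"
  shows "same_slant j t j' t'"
proof -
  have w: "w (int (vtx (cur j t))) = j mod 3" for j t
    by (simp add: w_vtx w_cur)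
  consider "vtx (cur j t) = vtx (cur j' t')" "vtx (cur (j + 1) t) = vtx (cur (j' + 1) t')"
    | "vtx (cur j t) = vtx (cur (j' + 1) t')" "vtx (cur (j + 1) t) = vtx (cur j' t')"
    using assms unfolding slant_def doubleton_eq_iff by blast
  then show ?thesis
  proof cases
    case 1
    then have "j mod 3 = j' mod 3"
      using w by metis
    then obtain k where k: "j = j' + 3 * k"
      by (metis mod_eqE)
    then have c: "cur j' s = cur j s" "cur (j' + 1) s = cur (j + 1) s" for s
      using cur_column[of j' k s] cur_column[of "j' + 1" k s] by (simp_all add: algebra_simps)
    obtain l l' where l: "cur j t = cur j t' + n * l" "cur (j + 1) t = cur (j + 1) t' + n * l'"
      using 1 unfolding vtx_eq_iff c by blast
    have "cur j t = cur j (t' + n * l)"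
      using l cur_period by simp
    \<comment> \<open>As long as the left end stays the same, the right end moves by less than a
      period; applied in both directions this gives \<open>l = l'\<close>.\<close>
    from cur_distinct[OF this, of "j + 1"] cur_distinct[OF this[symmetric], of "j + 1"]
    have "n * l < n * l' + n" "n * l' < n * l + n"
      using l unfolding cur_period by linarith+
    then have "n * l < n * (l' + 1)" "n * l' < n * (l + 1)"
      by (simp_all add: algebra_simps)
    then have "l < l' + 1" "l' < l + 1"
      using n_pos mult_less_cancel_left_pos by blast+
    then have "l = l'"
      by simp
    then show ?thesis
      unfolding same_slant_def using k l by blast
  next
    case 2
    \<comment> \<open>Exchanged ends would make 2 divisible by the number 3 of columns.\<close>
    then have "j mod 3 = (j' + 1) mod 3" "(j + 1) mod 3 = j' mod 3"
      using w by metis+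
    then show ?thesis
      by presburger
  qed
qed

definition slant_image :: "int \<Rightarrow> int \<Rightarrow> (complex \<times> complex) set" where
  "slant_image j t = (\<lambda>x::real. q (j + x) (height j t x)) ` {0..1}"

definition vert_image :: "int \<Rightarrow> (complex \<times> complex) set" where
  "vert_image t = (\<lambda>y. q (w t) y) ` {real_of_int (prev t)..real_of_int t}"

lemma slant_cong: "same_slant j t j' t' \<Longrightarrow> slant j t = slant j' t'"
proof -
  assume "same_slant j t j' t'"
  then obtain k l where k: "j = j' + 3 * k" and l: "cur j t = cur j t' + n * l" "cur (j + 1) t =
      cur (j + 1) t' + n * l"
    unfolding same_slant_def by blast
  have c: "cur j' s = cur j s" "cur (j' + 1) s = cur (j + 1) s" for s
    using k cur_column[of j' k s] cur_column[of "j' + 1" k s] by (simp_all add: algebra_simps)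
  have "vtx (cur j t) = vtx (cur j t')" "vtx (cur (j + 1) t) = vtx (cur (j + 1) t')"
    using l vtx_eq_iff by blast+
  then show ?thesis
    unfolding slant_def c by simp
qed

lemma slant_image_cong: "same_slant j t j' t' \<Longrightarrow> slant_image j t = slant_image j' t'"
proof -
  assume "same_slant j t j' t'"
  then obtain k l where k: "j = j' + 3 * k" and l: "cur j t = cur j t' + n * l" "cur (j + 1) t =
      cur (j + 1) t' + n * l"
    unfolding same_slant_def by blast
  have "height j t x = height j' t' x + n * l" for x
    using height_column[of j' k t' x] k l unfolding height_def by (simp add: algebra_simps)
  then have "q (j + x) (height j t x) = q (j' + x) (height j' t' x)" for x :: real
    unfolding q_eq_iff k by (intro exI[of _ k] exI[of _ l]) simp
  then show ?thesis
    unfolding slant_image_def by simp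
qed

lemma vert_period: "vert (t + n * k) = vert t"
  unfolding vert_def prev_period by (simp add: vtx_period)

lemma vert_image_period: "vert_image (t + n * k) = vert_image t"
proof -
  have 1: "{real_of_int (prev t + n * k)..real_of_int (t + n * k)} = (\<lambda>y. y + real_of_int n
      * real_of_int k) ` {real_of_int (prev t)..real_of_int t}"
    by (simp add: add.commute)
  have 2: "q (w t) (y + real_of_int n * real_of_int k) = q (w t) y" for y :: real
    unfolding q_eq_iff by (intro exI[of _ 0] exI[of _ k]) simp
  show ?thesis
    unfolding vert_image_def w_period prev_period 1 image_image 2 ..
qed

text \<open>If the ends of two vertical edges were exchanged, a vertex would be congruent to the
  predecessor of its predecessor, against \<open>prev_prev_greater\<close>, which says that a column
  has at least three vertices per period. In the proof \<open>s\<close> is the lift of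
  \<open>t'\<close> whose predecessor is \<open>t\<close>.\<close>

lemma vert_eqD: "vert t = vert t' \<Longrightarrow> \<exists>k. t = t' + n * k"
proof -
  assume "vert t = vert t'"
  then consider "vtx t = vtx t'" | "vtx t = vtx (prev t')" "vtx (prev t) = vtx t'"
    unfolding vert_def doubleton_eq_iff by blast
  then show ?thesis
  proof cases
    case 1
    then show ?thesis using vtx_eq_iff by blast
  next
    case 2
    then obtain k l where k: "t = prev t' + n * k" and l: "prev t = t' + n * l"
      using vtx_eq_iff by blast
    define s where "s = t' + n * k"
    have "prev s = t"
      unfolding s_def prev_period k ..
    then have "s - n < prev t" "prev t < s"
      using prev_prev_greater[of s] prev_less[of s] prev_less[of t] by auto
    then have "n * k < n * (l + 1)" "n * l < n * k"
      using l s_def by (simp_all add: algebra_simps)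
    then have "k < l + 1" "l < k"
      using n_pos mult_less_cancel_left_pos by blast+
    then show ?thesis by simp
  qed
qed

lemma vert_neq_slant: "vert t \<noteq> slant j t'"
proof
  assume "vert t = slant j t'"
  then have "vtx (cur j t') \<in> vert t" "vtx (cur (j + 1) t') \<in> vert t"
    unfolding slant_def by auto
  then have "j mod 3 = w t" "(j + 1) mod 3 = w t"
    unfolding vert_def by (metis insertE singletonD w_vtx w_cur w_prev)+
  then show False
    by presburger
qed

text \<open>The open segment from \<open>prev t\<close> to \<open>t\<close> contains no vertex of
  its column, so two such segments that meet in the plane have the same upper end.\<close>

lemma vert_eq_if_meet:
  fixes y y' :: real
  assumes "q (w t) y = q (w t') y'" "prev t < y" "y < t" "prev t' < y'" "y' < t'"
  shows "\<exists>k. t = t' + n * k"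
proof -
  obtain k l :: int where kl: "real_of_int (w t) = real_of_int (w t') + 3 * real_of_int k" "y = y'
      + real_of_int n * real_of_int l"
    using assms(1) unfolding q_eq_iff by blast
  have w: "w t = w t'"
    using kl(1) w_unique by blast
  define s where "s = t' + n * l"
  have ws: "w s = w t"
    unfolding s_def w_period w ..
  have s: "prev s < y" "y < s"
    unfolding s_def prev_period using kl assms by auto
  have "\<not> s < t"
  proof
    assume "s < t"
    then have "s \<le> prev t"
      using le_prev ws by blast
    then show False using s assms by linarith
  qed
  moreover have "\<not> t < s"
  proof
    assume "t < s"
    then have "t \<le> prev s"
      using le_prev ws by simp
    then show False using s assms by linarith
  qed
  ultimately have "t = s"
    by simp
  then show ?thesis
    unfolding s_def by blast
qed

lemma slant_interior_neq_column:
  fixes x y y' :: real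
  assumes "0 < x" "x < 1"
  shows "q (real_of_int j + x) y \<noteq> q (real_of_int j') y'"
proof
  assume "q (j + x) y = q (real_of_int j') y'"
  then obtain k :: int where "real_of_int j + x = real_of_int j' + 0 + 3 * real_of_int k"
    unfolding q_eq_iff by auto
  from column_coordinate_unique(2)[OF this] show False
    using assms by simp
qed

lemma vert_interior_neq_vertex:
  fixes y :: real
  assumes "prev t < y" "y < t" "v \<in> V"
  shows "q (w t) y \<noteq> pos v"
proof
  assume "q (w t) y = pos v"
  then obtain k l :: int where kl: "real_of_int (w t) = real_of_int (w v) + 3 * real_of_int k" "y =
      real v + real_of_int n * real_of_int l"
    unfolding pos_def q_eq_iff by auto
  define s where "s = int v + n * l"
  have "w t = w v"
    using kl(1) w_unique by blast
  then have "w s = w t"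
    unfolding s_def w_period by simp
  moreover have y: "y = s"
    using kl unfolding s_def by simp
  ultimately have "s \<le> prev t"
    using le_prev assms by simp
  then show False
    using y assms by simp
qed

lemma slant_image_cases:
  assumes "z \<in> slant_image j t"
  obtains "z \<in> pos ` slant j t" | x :: real where "0 < x" "x < 1" "z = q (j + x) (height j t x)"
proof -
  obtain x :: real where x: "0 \<le> x" "x \<le> 1" "z = q (j + x) (height j t x)"
    using assms unfolding slant_image_def by auto
  have "pos (vtx (cur j t)) = q j (cur j t)" "pos (vtx (cur (j + 1) t)) = q (real_of_int (j + 1))
      (cur (j + 1) t)"
    by (rule pos_vtx, simp add: w_cur)+
  then have "x = 0 \<Longrightarrow> z \<in> pos ` slant j t" "x = 1 \<Longrightarrow> z \<in> pos
      ` slant j t"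
    using x unfolding slant_def height_def by auto
  then show ?thesis
    using that x by (metis less_eq_real_def)
qed

lemma pos_slant_subset: "pos ` slant j t \<subseteq> slant_image j t"
proof -
  have "pos (vtx (cur j t)) = q (j + 0) (height j t 0)" "pos (vtx (cur (j + 1) t)) = q (j + 1)
      (height j t 1)"
    using pos_vtx[of "cur j t" j] pos_vtx[of "cur (j + 1) t" "j + 1"] by (simp_all add: w_cur height_def)
  moreover have "q (j + x) (height j t x) \<in> slant_image j t" if "x \<in> {0..1}" for x :: real
    using that unfolding slant_image_def by blast
  from this[of 0] this[of 1] have "q (j + 0) (height j t 0) \<in> slant_image j t" "q (j + 1)
      (height j t 1) \<in> slant_image j t"
    by simp_all
  ultimately show ?thesis
    unfolding slant_def by simp
qed

lemma pos_vert: "pos (vtx t) = q (w t) t" "pos (vtx (prev t)) = q (w t) (prev t)"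
  by (rule pos_vtx, simp add: w_mod w_prev)+

lemma vert_image_cases:
  assumes "z \<in> vert_image t"
  obtains "z \<in> pos ` vert t" | y :: real where "prev t < y" "y < t" "z = q (w t) y"
proof -
  obtain y :: real where y: "prev t \<le> y" "y \<le> t" "z = q (w t) y"
    using assms unfolding vert_image_def by auto
  consider "y = t" | "y = prev t" | "prev t < y" "y < t"
    using y by linarith
  then show ?thesis
  proof cases
    case 3
    then show ?thesis
      using that(2) y(3) by blast
  qed (use that(1) y(3) pos_vert[of t] in \<open>auto simp: vert_def\<close>)
qed

lemma pos_vert_subset: "pos ` vert t \<subseteq> vert_image t"
  using pos_vert[of t] prev_less[of t] unfolding vert_def vert_image_def by auto

lemma slant_image_Int_vertices: "slant_image j t \<inter> pos ` V = pos ` slant j t"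
proof
  show "slant_image j t \<inter> pos ` V \<subseteq> pos ` slant j t"
  proof
    fix z assume z: "z \<in> slant_image j t \<inter> pos ` V"
    then have "z \<in> slant_image j t" by simp
    then show "z \<in> pos ` slant j t"
    proof (cases rule: slant_image_cases)
      case (2 x)
      then show ?thesis
        using z slant_interior_neq_column unfolding pos_def by auto
    qed
  qed
  show "pos ` slant j t \<subseteq> slant_image j t \<inter> pos ` V"
    using pos_slant_subset vtx_in_V unfolding slant_def by auto
qed

lemma vert_image_Int_vertices: "vert_image t \<inter> pos ` V = pos ` vert t"
proof
  show "vert_image t \<inter> pos ` V \<subseteq> pos ` vert t"
  proof
    fix z assume z: "z \<in> vert_image t \<inter> pos ` V"
    then have "z \<in> vert_image t" by simp
    then show "z \<in> pos ` vert t"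
    proof (cases rule: vert_image_cases)
      case (2 x)
      then show ?thesis
        using z vert_interior_neq_vertex by auto
    qed
  qed
  show "pos ` vert t \<subseteq> vert_image t \<inter> pos ` V"
    using pos_vert_subset vtx_in_V unfolding vert_def by auto
qed

section \<open>Edge paths and the embedding of the graph\<close>

lemma slant_path_apply: "slant_path j t x = q (j + x) (height j t x)"
  unfolding slant_path_def linepath_def height_def by (simp add: algebra_simps)

lemma vert_path_apply:
  "vert_path t x = q (w t) (real_of_int (prev t) + x * (real_of_int t - real_of_int (prev t)))"
  unfolding vert_path_def linepath_def by (simp add: algebra_simps)

lemma path_image_slant_path: "path_image (slant_path j t) = slant_image j t"
  unfolding path_image_def slant_image_def by (simp add: slant_path_apply)

lemma path_image_vert_path: "path_image (vert_path t) = vert_image t"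
proof -
  have "path_image (vert_path t) = (\<lambda>y. q (w t) y) ` closed_segment (prev t) t"
    unfolding path_image_def linepath_image_01[symmetric] image_image
    by (simp add: vert_path_apply linepath_def algebra_simps)
  then show ?thesis
    unfolding vert_image_def using prev_less[of t] by (simp add: closed_segment_eq_real_ivl)
qed

lemma arc_slant_path: "arc (slant_path j t)"
  unfolding arc_def
proof
  show "path (slant_path j t)"
    unfolding slant_path_def by (intro path_continuous_image path_linepath continuous_on_torus_cover)
  show "inj_on (slant_path j t) {0..1}"
  proof (rule inj_onI)
    fix x x' :: real assume x: "x \<in> {0..1}" "x' \<in> {0..1}" "slant_path j t x = slant_path j t x'"
    then obtain k :: int where "real_of_int j + x = real_of_int j + x' + 3 * real_of_int k"
      unfolding slant_path_apply q_eq_iff by blast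
    moreover then have "k = 0"
      using x by simp
    ultimately show "x = x'"
      by simp
  qed
qed

text \<open>A vertical segment shorter than the period \<open>n\<close> does not wrap around the
  torus; the edges and the sections of triangles are short enough by
  \<open>prev_greater\<close>.\<close>

lemma q_column_inj:
  assumes "q x y = q x y'" "\<bar>y - y'\<bar> < n"
  shows "y = y'"
proof -
  obtain l :: int where l: "y = y' + real_of_int n * real_of_int l"
    using assms unfolding q_eq_iff by auto
  then have "real_of_int n * \<bar>l\<bar> < n * 1"
    using assms(2) n_pos by (simp add: abs_mult)
  then have "\<bar>l\<bar> < 1"
    using n_pos by (simp add: mult_less_cancel_left_pos)
  then show ?thesis
    using l by simp
qed

lemma arc_vert_path: "arc (vert_path t)"
  unfolding arc_def
proof
  show "path (vert_path t)"
    unfolding vert_path_def by (intro path_continuous_image path_linepath continuous_on_torus_cover)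
  show "inj_on (vert_path t) {0..1}"
  proof (rule inj_onI)
    fix x x' :: real assume x: "x \<in> {0..1}" "x' \<in> {0..1}" "vert_path t x = vert_path t x'"
    define d where "d = real_of_int t - prev t"
    have d: "0 < d" "d < n"
      using prev_less[of t] prev_greater[of t] unfolding d_def by linarith+
    have "\<bar>x - x'\<bar> * d \<le> 1 * d"
      using x d by (intro mult_right_mono) auto
    moreover have "\<bar>(x - x') * d\<bar> = \<bar>x - x'\<bar> * d"
      using d by (simp add: abs_mult)
    ultimately have "\<bar>(x - x') * d\<bar> < n"
      using d by linarith
    moreover have "(prev t + x * d) - (prev t + x' * d) = (x - x') * d"
      by (simp add: algebra_simps)
    ultimately have "prev t + x * d = prev t + x' * d"
      using q_column_inj[of "w t"] x(3) unfolding vert_path_apply d_def by metis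
    then show "x = x'"
      using d by simp
  qed
qed

lemma edge_path_cases:
  assumes "e \<in> E"
  obtains j t where "e = slant j t" "edge_path e = slant_path j t"
  | t where "e = vert t" "edge_path e = vert_path t"
proof -
  have "\<exists>g. (\<exists>j t. e = slant j t \<and> g = slant_path j t) \<or> (\<exists>t. e =
      vert t \<and> g = vert_path t)"
    using assms unfolding E_def by auto
  from someI_ex[OF this] show ?thesis
    using that unfolding edge_path_def[symmetric] by blast
qed

lemma slant_in_E: "slant j t \<in> E" and vert_in_E: "vert t \<in> E"
  unfolding E_def by auto

lemma path_image_edge_path_slant: "path_image (edge_path (slant j t)) = slant_image j t"
  using slant_in_E[of j t]
proof (cases rule: edge_path_cases)
  case (1 j' t')
  then show ?thesis
    using path_image_slant_path slant_image_cong same_slant_if_eq by metis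
next
  case (2 t')
  then show ?thesis
    using vert_neq_slant by metis
qed

lemma path_image_edge_path_vert: "path_image (edge_path (vert t)) = vert_image t"
  using vert_in_E[of t]
proof (cases rule: edge_path_cases)
  case (1 j' t')
  then show ?thesis
    using vert_neq_slant by metis
next
  case (2 t')
  then show ?thesis
    using path_image_vert_path vert_image_period vert_eqD by metis
qed

lemma slant_images_meet:
  assumes "slant j t \<noteq> slant j' t'"
  shows "slant_image j t \<inter> slant_image j' t' \<subseteq> pos ` V"
proof
  fix z assume "z \<in> slant_image j t \<inter> slant_image j' t'"
  then have z: "z \<in> slant_image j t" "z \<in> slant_image j' t'" by auto
  have V: "pos ` slant i s \<subseteq> pos ` V" for i s
    using slant_image_Int_vertices by blast
  from z(1) show "z \<in> pos ` V"
  proof (cases rule: slant_image_cases)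
    case (2 x)
    from z(2) show ?thesis
    proof (cases rule: slant_image_cases)
      case (2 x')
      then have "same_slant j t j' t'"
        using same_slant_if_meet[of j x t j' x' t'] \<open>0 < x\<close> \<open>x < 1\<close>
            \<open>z = q (j + x) (height j t x)\<close> by simp
      then show ?thesis
        using slant_cong assms by blast
    qed (use V in blast)
  qed (use V in blast)
qed

lemma vert_images_meet:
  assumes "vert t \<noteq> vert t'"
  shows "vert_image t \<inter> vert_image t' \<subseteq> pos ` V"
proof
  fix z assume "z \<in> vert_image t \<inter> vert_image t'"
  then have z: "z \<in> vert_image t" "z \<in> vert_image t'" by auto
  have V: "pos ` vert s \<subseteq> pos ` V" for s
    using vert_image_Int_vertices by blast
  from z(1) show "z \<in> pos ` V"
  proof (cases rule: vert_image_cases)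
    case (2 y)
    from z(2) show ?thesis
    proof (cases rule: vert_image_cases)
      case (2 y')
      have "\<exists>k. t = t' + n * k"
        using vert_eq_if_meet[of t y t' y'] \<open>prev t < y\<close> \<open>y < t\<close> \<open>z
            = q (w t) y\<close> 2 by simp
      then show ?thesis
        using vert_period assms by auto
    qed (use V in blast)
  qed (use V in blast)
qed

lemma slant_vert_images_meet: "slant_image j t \<inter> vert_image t' \<subseteq> pos ` V"
proof
  fix z assume z: "z \<in> slant_image j t \<inter> vert_image t'"
  then have "z \<in> slant_image j t" by simp
  then show "z \<in> pos ` V"
  proof (cases rule: slant_image_cases)
    case 1
    then show ?thesis
      using slant_image_Int_vertices by blast
  next
    case (2 x)
    obtain y where "z = q (w t') y"
      using z unfolding vert_image_def by auto
    then show ?thesis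
      using slant_interior_neq_column[of x j "height j t x" "w t'" y] 2 by simp
  qed
qed

lemma q_in_torus: "q x y \<in> torus"
  using range_torus_cover[of 3 "real_of_int n"] n_pos by auto

lemma edge_subset_V: "e \<in> E \<Longrightarrow> e \<subseteq> V"
  unfolding E_def slant_def vert_def using vtx_in_V by auto

lemma edge_images_meet:
  assumes "e \<in> E" "f \<in> E" "e \<noteq> f"
  shows "path_image (edge_path e) \<inter> path_image (edge_path f) \<subseteq> pos ` V"
  using assms(1)
proof (cases rule: edge_path_cases)
  case e: (1 j t)
  from assms(2) show ?thesis
  proof (cases rule: edge_path_cases)
    case (1 j' t')
    then show ?thesis
      using e assms(3) slant_images_meet path_image_slant_path by metis
  next
    case (2 t')
    then show ?thesis
      using e slant_vert_images_meet path_image_slant_path path_image_vert_path by metis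
  qed
next
  case e: (2 t)
  from assms(2) show ?thesis
  proof (cases rule: edge_path_cases)
    case (1 j' t')
    then show ?thesis
      using e slant_vert_images_meet path_image_slant_path path_image_vert_path by (metis Int_commute)
  next
    case (2 t')
    then show ?thesis
      using e assms(3) vert_images_meet path_image_vert_path by metis
  qed
qed

lemma edge_image_Int_vertices:
  assumes "e \<in> E"
  shows "path_image (edge_path e) \<inter> pos ` V = pos ` e"
  using assms
  by (cases rule: edge_path_cases)
    (simp_all add: path_image_slant_path path_image_vert_path slant_image_Int_vertices
        vert_image_Int_vertices)

lemma edge_path_ends:
  assumes "e \<in> E"
  shows "{pathstart (edge_path e), pathfinish (edge_path e)} = pos ` e"
  using assms
proof (cases rule: edge_path_cases)
  case (1 j t)
  have "slant_path j t 0 = pos (vtx (cur j t))" "slant_path j t 1 = pos (vtx (cur (j + 1) t))"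
    using pos_vtx[of "cur j t" j] pos_vtx[of "cur (j + 1) t" "j + 1"]
    by (simp_all add: w_cur height_def slant_path_apply)
  then show ?thesis
    using 1 unfolding pathstart_def pathfinish_def by (simp add: slant_def)
next
  case (2 t)
  have "vert_path t 0 = pos (vtx (prev t))" "vert_path t 1 = pos (vtx t)"
    using pos_vert[of t] by (simp_all add: vert_path_apply)
  then show ?thesis
    using 2 unfolding pathstart_def pathfinish_def by (auto simp: vert_def)
qed

lemma graph_embedding_columns: "graph_embedding torus V E pos edge_path"
  unfolding graph_embedding_def
proof (intro conjI ballI impI)
  show "inj_on pos V" by (rule inj_on_pos)
  show "pos ` V \<subseteq> torus"
    unfolding pos_def using q_in_torus by auto
  fix e assume e: "e \<in> E"
  show "arc (edge_path e)"
    using e by (cases rule: edge_path_cases) (simp_all add: arc_slant_path arc_vert_path)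
  show "path_image (edge_path e) \<subseteq> torus"
    using e q_in_torus
    by (cases rule: edge_path_cases) (auto simp: path_image_def slant_path_apply vert_path_apply)
  show "{pathstart (edge_path e), pathfinish (edge_path e)} = pos ` e"
    by (rule edge_path_ends[OF e])
  show "path_image (edge_path e) \<inter> pos ` V = pos ` e"
    by (rule edge_image_Int_vertices[OF e])
  fix f assume f: "f \<in> E" "e \<noteq> f"
  \<comment> \<open>Distinct edges meet only in vertices, and an edge contains no vertices besides
    its own ends.\<close>
  have "path_image (edge_path e) \<inter> path_image (edge_path f) = pos ` e \<inter> pos ` f"
    using edge_images_meet[OF e f] edge_image_Int_vertices[OF e] edge_image_Int_vertices[OF f(1)] by blast
  also have "\<dots> = pos ` (e \<inter> f)"
    using inj_on_image_Int[OF inj_on_pos] edge_subset_V e f by simp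
  finally show "path_image (edge_path e) \<inter> path_image (edge_path f) = pos ` (e \<inter> f)" .
qed

lemma vtx_prev_neq: "vtx (prev t) \<noteq> vtx t"
proof
  assume "vtx (prev t) = vtx t"
  then obtain k where k: "prev t = t + n * k"
    using vtx_eq_iff by blast
  then have "n * k < n * 0" "n * (-1) < n * k"
    using prev_less[of t] prev_greater[of t] by (simp_all)
  then have "k < 0" "-1 < k"
    using n_pos mult_less_cancel_left_pos by blast+
  then show False by simp
qed

lemma vtx_column_neq: "j mod 3 \<noteq> j' mod 3 \<Longrightarrow> vtx (cur j t) \<noteq> vtx (cur j' t')"
  using w_vtx w_cur by metis

lemma simple_graph_columns: "simple_graph V E"
  unfolding simple_graph_def
proof (intro conjI ballI)
  show "finite V" by (simp add: V_def)
  fix e assume e: "e \<in> E"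
  then show "e \<subseteq> V" by (rule edge_subset_V)
  have "j mod 3 \<noteq> (j + 1) mod 3" for j :: int
    by presburger
  then have "card (slant j t) = 2" for j t
    unfolding slant_def using vtx_column_neq[of j "j + 1" t t] by simp
  moreover have "card (vert t) = 2" for t
    unfolding vert_def using vtx_prev_neq[of t] by (metis card_2_iff)
  ultimately show "card e = 2"
    using e unfolding E_def by auto
qed

section \<open>The triangles as faces of the embedding\<close>

definition active :: "int \<Rightarrow> int \<Rightarrow> bool" where
  "active j t \<longleftrightarrow> w t = j mod 3 \<or> w t = (j + 1) mod 3"

text \<open>When \<open>t\<close> lies on a side of strip \<open>j\<close>, that is
  \<open>active j t\<close>, passing from \<open>t - 1\<close> to \<open>t\<close> moves exactly one
  end of the graph, from \<open>prev t\<close> to \<open>t\<close>, and the graph sweeps out this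
  triangle with one vertical side. For all other \<open>t\<close> the graph stays put and the region
  is empty.\<close>

definition open_triangle :: "int \<Rightarrow> int \<Rightarrow> (real \<times> real) set" where
  "open_triangle j t = {(x, y). real_of_int j < x \<and> x < real_of_int j + 1
    \<and> height j (t - 1) (x - real_of_int j) < y \<and> y < height j t (x - real_of_int j)}"

definition closed_triangle :: "int \<Rightarrow> int \<Rightarrow> (real \<times> real) set" where
  "closed_triangle j t = {(x, y). real_of_int j \<le> x \<and> x \<le> real_of_int j + 1
    \<and> height j (t - 1) (x - real_of_int j) \<le> y \<and> y \<le> height j t (x - real_of_int j)}"

lemma height_left:
  assumes "w t = j mod 3"
  shows "height j (t - 1) x = prev t + (real_of_int (cur (j + 1) t) - prev t) * x"
    and "height j t x = t + (real_of_int (cur (j + 1) t) - t) * x"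
proof -
  have "w t \<noteq> (j + 1) mod 3"
    using assms by presburger
  then show "height j (t - 1) x = prev t + (real_of_int (cur (j + 1) t) - prev t) * x"
    and "height j t x = t + (real_of_int (cur (j + 1) t) - t) * x"
    unfolding height_def using cur_other[of t "j + 1"] cur_self[OF assms] cur_prev[OF assms] by simp_all
qed

lemma height_right:
  assumes "w t = (j + 1) mod 3"
  shows "height j (t - 1) x = cur j t + (real_of_int (prev t) - cur j t) * x"
    and "height j t x = cur j t + (real_of_int t - cur j t) * x"
proof -
  have "w t \<noteq> j mod 3"
    using assms by presburger
  then show "height j (t - 1) x = cur j t + (real_of_int (prev t) - cur j t) * x"
    and "height j t x = cur j t + (real_of_int t - cur j t) * x"
    unfolding height_def using cur_other[of t j] cur_self[OF assms] cur_prev[OF assms] by simp_all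
qed

lemma height_gap:
  assumes "active j t"
  shows "height j t x - height j (t - 1) x = (if w t = j mod 3 then 1 - x else x) * (real_of_int t
      - prev t)"
  using assms height_left[of t j x] height_right[of t j x] unfolding active_def
  by (auto simp: algebra_simps)

lemma height_gap_pos:
  assumes "active j t" "0 < x" "x < 1"
  shows "height j (t - 1) x < height j t x"
proof -
  have "0 < (if w t = j mod 3 then 1 - x else x) * (real_of_int t - prev t)"
    using assms prev_less[of t] by simp
  then show ?thesis
    using height_gap[OF assms(1), of x] by linarith
qed

lemma height_gap_less:
  assumes "active j t" "0 \<le> x" "x \<le> 1"
  shows "height j t x - height j (t - 1) x < n"
proof -
  have "(if w t = j mod 3 then 1 - x else x) * (real_of_int t - prev t) \<le> 1 * (real_of_int t - prev t)"
    using assms prev_less[of t] by (intro mult_right_mono) auto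
  moreover have "real_of_int t - prev t < n"
    using prev_greater[of t] by linarith
  ultimately show ?thesis
    unfolding height_gap[OF assms(1)] mult_1 by (rule le_less_trans)
qed

lemma open_triangle_homeomorphic:
  assumes "active j t"
  shows "open_triangle j t homeomorphic ball (0::complex) 1"
proof -
  have "height j (t - 1) (x - real_of_int j) < height j t (x - real_of_int j)"
    if "real_of_int j < x" "x < real_of_int j + 1" for x
    using height_gap_pos[OF assms, of "x - j"] that by simp
  then show ?thesis
    unfolding open_triangle_def height_def by (rule homeomorphic_region_between_affine)
qed

lemma compact_closed_triangle: "active j t \<Longrightarrow> compact (closed_triangle j t)"
  and closed_triangle_subset_closure: "active j t \<Longrightarrow> closed_triangle j t \<subseteq>
      closure (open_triangle j t)"
proof -
  assume *: "active j t"
  have less: "height j (t - 1) (x - real_of_int j) < height j t (x - real_of_int j)"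
    if "real_of_int j < x" "x < real_of_int j + 1" for x
    using height_gap_pos[OF *, of "x - j"] that by simp
  show "compact (closed_triangle j t)"
    using less unfolding closed_triangle_def height_def by (rule closed_region_between_affine)
  show "closed_triangle j t \<subseteq> closure (open_triangle j t)"
    using less unfolding closed_triangle_def open_triangle_def height_def by (rule
        closed_region_between_affine)
qed

lemma open_subset_closed_triangle: "open_triangle j t \<subseteq> closed_triangle j t"
  unfolding open_triangle_def closed_triangle_def by auto

abbreviation cover :: "real \<times> real \<Rightarrow> complex \<times> complex" where
  "cover \<equiv> torus_cover 3 (real_of_int n)"

text \<open>A triangle has width 1, less than the period 3, and its vertical sections are shorter
  than \<open>n\<close>, so no two of its points are congruent.\<close>

lemma inj_on_closed_triangle:
  assumes "active j t"
  shows "inj_on cover (closed_triangle j t)"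
proof (rule inj_onI, clarify)
  fix x y x' y' :: real
  assume a: "(x, y) \<in> closed_triangle j t" "(x', y') \<in> closed_triangle j t" "q x y = q x' y'"
  then obtain k :: int where "x = x' + 3 * real_of_int k"
    unfolding q_eq_iff by blast
  moreover have "\<bar>x - x'\<bar> \<le> 1"
    using a unfolding closed_triangle_def by auto
  ultimately have x: "x = x'"
    by simp
  have "\<bar>y - y'\<bar> < n"
    using a height_gap_less[OF assms, of "x - j"] unfolding closed_triangle_def x by auto
  then show "x = x' \<and> y = y'"
    using q_column_inj[of x y y'] a(3) x by simp
qed

text \<open>After a translation both points lie in the same strip, where the layers between
  consecutive graphs are ordered by \<open>t\<close>; a common point therefore determines the
  layer.\<close>

lemma open_triangles_meet:
  assumes "(x, y) \<in> open_triangle j t" "(x', y') \<in> open_triangle j' t'" "q x y = q x' y'"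
  shows "\<exists>k l. j = j' + 3 * k \<and> t = t' + n * l"
proof -
  obtain k l :: int where kl: "x = x' + 3 * real_of_int k" "y = y' + real_of_int n * real_of_int l"
    using assms(3) unfolding q_eq_iff by blast
  define u where "u = x - real_of_int j"
  have xy: "0 < u" "u < 1" "height j (t - 1) u < y" "y < height j t u"
    using assms(1) unfolding open_triangle_def u_def by auto
  have "real_of_int j + u = real_of_int j' + (x' - real_of_int j') + 3 * real_of_int k"
    using kl unfolding u_def by simp
  from column_coordinate_unique[OF this] have j: "j = j' + 3 * k" and u: "u = x' - real_of_int j'"
    using xy assms(2) unfolding open_triangle_def by auto
  define s where "s = t' + n * l"
  have "height j (s - 1) u = height j' (t' - 1) u + real_of_int n * real_of_int l"
    "height j s u = height j' t' u + real_of_int n * real_of_int l"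
    using height_period[of j "t' - 1" l u] height_period[of j t' l u]
    unfolding s_def j height_column by (simp_all add: algebra_simps)
  then have s: "height j (s - 1) u < y" "y < height j s u"
    using assms(2) kl unfolding open_triangle_def u by auto
  have "\<not> s \<le> t - 1" "\<not> t \<le> s - 1"
    using height_mono[of s "t - 1" u j] height_mono[of t "s - 1" u j] s xy by auto
  then have "t = s"
    by simp
  then show ?thesis
    using j unfolding s_def by blast
qed

lemma open_triangle_image_period:
  "cover ` open_triangle (j + 3 * k) (t + n * l) = cover ` open_triangle j t"
proof -
  have sub: "cover ` open_triangle j t \<subseteq> cover ` open_triangle (j + 3 * k) (t + n * l)"
      for j t k l
  proof (rule image_subsetI)
    fix z assume "z \<in> open_triangle j t"
    then obtain x y where z: "z = (x, y)" "(x, y) \<in> open_triangle j t"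
      by (cases z) auto
    have "height (j + 3 * k) (t + n * l - 1) u = height j (t - 1) u + real_of_int n * real_of_int l"
      "height (j + 3 * k) (t + n * l) u = height j t u + real_of_int n * real_of_int l" for u
      using height_period[of j "t - 1" l u] height_period[of j t l u]
      unfolding height_column by (simp_all add: algebra_simps)
    then have "(x + 3 * real_of_int k, y + real_of_int n * real_of_int l) \<in> open_triangle (j +
        3 * k) (t + n * l)"
      using z(2) unfolding open_triangle_def by (auto simp: algebra_simps)
    moreover have "cover z = q (x + 3 * real_of_int k) (y + real_of_int n * real_of_int l)"
      unfolding z(1) q_eq_iff by (intro exI[of _ "-k"] exI[of _ "-l"]) simp
    ultimately show "cover z \<in> cover ` open_triangle (j + 3 * k) (t + n * l)"
      by blast
  qed
  from sub[of "j + 3 * k" "t + n * l" "-k" "-l"] sub[of j t k l] show ?thesis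
    by simp
qed

lemma closed_triangle_image_eq:
  assumes "active j t"
  shows "cover ` closed_triangle j t = cover ` open_triangle j t \<union> (slant_image j (t - 1)
      \<union> slant_image j t \<union> vert_image t)"
proof (intro equalityI subsetI)
  fix z assume "z \<in> cover ` closed_triangle j t"
  then obtain x y where z: "z = q x y" and xy: "(x, y) \<in> closed_triangle j t"
    by auto
  define u where "u = x - real_of_int j"
  have x: "x = real_of_int j + u"
    unfolding u_def by simp
  have u: "0 \<le> u" "u \<le> 1" "height j (t - 1) u \<le> y" "y \<le> height j t u"
    using xy unfolding closed_triangle_def u_def by auto
  have slant: "z \<in> slant_image j s" if "y = height j s u" for s
    unfolding slant_image_def z x that using u by auto
  have vert: "z \<in> vert_image t" if "w t = i mod 3" "x = real_of_int i" "prev t \<le> y" "y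
      \<le> t" for i
  proof -
    have "real_of_int i = real_of_int (w t) + 3 * real_of_int (i div 3)"
      using that(1) by (metis mod_mult_div_eq of_int_add of_int_mult of_int_numeral)
    then have "z = q (w t) y"
      unfolding z that(2) q_eq_iff by (intro exI[of _ "i div 3"] exI[of _ 0]) simp
    then show ?thesis
      unfolding vert_image_def using that by auto
  qed
  \<comment> \<open>Over the side of the strip that contains \<open>t\<close> the section is the
    vertical edge; over the opposite side both graphs meet in a vertex; in between, a boundary point
    lies on one of the two graphs.\<close>
  consider "u = 0" "w t = j mod 3" | "u = 1" "w t = j mod 3" | "u = 0" "w t = (j + 1) mod 3"
    | "u = 1" "w t = (j + 1) mod 3" | "0 < u" "u < 1"
    using u assms unfolding active_def by linarith
  then show "z \<in> cover ` open_triangle j t \<union> (slant_image j (t - 1) \<union> slant_image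
      j t \<union> vert_image t)"
  proof cases
    case 1
    then show ?thesis
      using vert[of j] u x height_left[of t j u] by simp
  next
    case 2
    then show ?thesis
      using slant[of t] u height_left[of t j u] by simp
  next
    case 3
    then show ?thesis
      using slant[of t] u height_right[of t j u] by simp
  next
    case 4
    then show ?thesis
      using vert[of "j + 1"] u x height_right[of t j u] by simp
  next
    case 5
    then consider "y = height j (t - 1) u" | "y = height j t u" | "(x, y) \<in> open_triangle j t"
      using u x unfolding open_triangle_def by force
    then show ?thesis
      using slant z by cases auto
  qed
next
  fix z assume z: "z \<in> cover ` open_triangle j t \<union> (slant_image j (t - 1) \<union>
      slant_image j t \<union> vert_image t)"
  have slant: "z \<in> cover ` closed_triangle j t" if "z \<in> slant_image j s" "s = t - 1 \<or> s
      = t" for s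
  proof -
    obtain u :: real where u: "0 \<le> u" "u \<le> 1" "z = q (j + u) (height j s u)"
      using \<open>z \<in> slant_image j s\<close> unfolding slant_image_def by auto
    have "(j + u, height j s u) \<in> closed_triangle j t"
      using u that(2) height_mono[of "t - 1" t u j] unfolding closed_triangle_def by auto
    then show ?thesis
      using u by blast
  qed
  have vert: "z \<in> cover ` closed_triangle j t" if vi: "z \<in> vert_image t"
  proof -
    obtain y :: real where y: "prev t \<le> y" "y \<le> t" "z = q (w t) y"
      using vi unfolding vert_image_def by auto
    obtain i :: int where i: "w t = i mod 3" "i = j \<or> i = j + 1"
      using assms unfolding active_def by blast
    have "real_of_int i = real_of_int (w t) + 3 * real_of_int (i div 3)"
      using i(1) by (metis mod_mult_div_eq of_int_add of_int_mult of_int_numeral)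
    then have "z = q i y"
      unfolding y q_eq_iff by (intro exI[of _ "- (i div 3)"] exI[of _ 0]) simp
    moreover have "(real_of_int i, y) \<in> closed_triangle j t"
      using i y height_left[of t j 0] height_right[of t j 1] unfolding closed_triangle_def by auto
    ultimately show ?thesis
      by blast
  qed
  show "z \<in> cover ` closed_triangle j t"
    using z slant vert open_subset_closed_triangle by blast
qed

definition graph_image :: "(complex \<times> complex) set" where
  "graph_image = pos ` V \<union> (\<Union>e\<in>E. path_image (edge_path e))"

lemma graph_image_cases:
  assumes "z \<in> graph_image"
  obtains (column) i y where "z = q (real_of_int i) y"
  | (slant) i s u where "0 < u" "u < 1" "z = q (real_of_int i + u) (height i s u)"
proof -
  have V: thesis if "z \<in> pos ` V"
    using that column unfolding pos_def by auto
  show thesis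
  proof (cases "z \<in> pos ` V")
    case False
    then obtain e where e: "e \<in> E" "z \<in> path_image (edge_path e)"
      using assms unfolding graph_image_def by blast
    from e(1) show thesis
    proof (cases rule: edge_path_cases)
      case (1 j t)
      then have "z \<in> slant_image j t"
        using e(2) path_image_slant_path by simp
      then show thesis
        using V slant slant_image_Int_vertices by (cases rule: slant_image_cases) blast+
    next
      case (2 t)
      then have "z \<in> vert_image t"
        using e(2) path_image_vert_path by simp
      then show thesis
        using column unfolding vert_image_def by auto
    qed
  qed (rule V)
qed

lemma open_triangle_disjoint_graph: "cover ` open_triangle j t \<inter> graph_image = {}"
proof -
  have False if z: "z \<in> cover ` open_triangle j t" "z \<in> graph_image" for z
  proof -
    obtain x y where xy: "z = q x y" "(x, y) \<in> open_triangle j t"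
      using z(1) by auto
    define u where "u = x - real_of_int j"
    have x: "x = real_of_int j + u"
      unfolding u_def by simp
    have u: "0 < u" "u < 1" "height j (t - 1) u < y" "y < height j t u"
      using xy unfolding open_triangle_def u_def by auto
    from z(2) show False
    proof (cases rule: graph_image_cases)
      case (column i y')
      then show False
        using slant_interior_neq_column[of u j y i y'] u xy x by simp
    next
      case (slant i s v)
      then obtain k l :: int where kl: "real_of_int j + u = real_of_int i + v + 3 * real_of_int k"
        "y = height i s v + real_of_int n * real_of_int l"
        using xy x q_eq_iff by metis
      have j: "j = i + 3 * k" "u = v"
        using column_coordinate_unique[OF kl(1)] u slant by auto
      have "y = height j (s + n * l) u"
        using kl(2) j height_column height_period by simp
      then show False
        using height_mono[of "s + n * l" "t - 1" u j] height_mono[of t "s + n * l" u j] u by linarith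
    qed
  qed
  then show ?thesis
    by blast
qed

definition cells :: "(int \<times> int) set" where
  "cells = {(j, t) \<in> {0..<3} \<times> {0..<n}. active j t}"

lemma torus_covered: "torus = (\<Union>(j, t)\<in>cells. cover ` closed_triangle j t)"
proof (intro equalityI subsetI)
  fix z assume "z \<in> torus"
  then obtain x y where z: "z = q x y"
    using range_torus_cover[of 3 "real_of_int n"] n_pos by fastforce
  define j where "j = \<lfloor>x\<rfloor>"
  define u where "u = x - j"
  have u: "0 \<le> u" "u < 1"
    unfolding u_def j_def by linarith+
  let ?h = "\<lambda>t. height j t u"
  \<comment> \<open>Adding a period to \<open>t\<close> raises the graph by \<open>n\<close>, so the
    graphs start below \<open>y\<close> and end above it, and some step crosses. The strict
    inequality on one side makes the two graphs differ, which is why \<open>t\<close> is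
    active.\<close>
  have "\<exists>t. ?h (t - 1) \<le> y \<and> y < ?h t"
  proof -
    obtain k where k: "y < real_of_int n * real_of_int k + ?h 0"
    proof -
      have "(y - ?h 0) / n < \<lfloor>(y - ?h 0) / n\<rfloor> + 1"
        by linarith
      then have "y - ?h 0 < (\<lfloor>(y - ?h 0) / n\<rfloor> + 1) * real_of_int n"
        using n_pos pos_divide_less_eq[of "real_of_int n"] of_int_0_less_iff by blast
      then show thesis
        by (intro that[of "\<lfloor>(y - ?h 0) / n\<rfloor> + 1"]) (simp add: algebra_simps)
    qed
    obtain k' where k': "real_of_int n * real_of_int k' + ?h 0 \<le> y"
    proof -
      have "\<lfloor>(y - ?h 0) / n\<rfloor> \<le> (y - ?h 0) / n"
        by linarith
      then have "\<lfloor>(y - ?h 0) / n\<rfloor> * real_of_int n \<le> y - ?h 0"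
        using n_pos pos_le_divide_eq[of "real_of_int n"] of_int_0_less_iff by blast
      then show thesis
        by (intro that[of "\<lfloor>(y - ?h 0) / n\<rfloor>"]) (simp add: algebra_simps)
    qed
    have hi: "y < ?h (0 + n * k)" and lo: "?h (0 + n * k') \<le> y"
      using k k' unfolding height_period by simp_all
    have "n * k' < n * k"
      using hi lo height_mono[of "n * k" "n * k'" u j] u by force
    define P where "P m \<longleftrightarrow> y < ?h (n * k' + int m)" for m
    have "P (nat (n * k - n * k'))"
      unfolding P_def using hi \<open>n * k' < n * k\<close> by simp
    moreover have "\<not> P 0"
      unfolding P_def using lo by simp
    ultimately obtain m where "\<not> P m" "P (Suc m)"
      using nat_induct[of "\<lambda>m. \<not> P m"] by blast
    then show ?thesis
      unfolding P_def by (intro exI[of _ "n * k' + int m + 1"]) (simp add: algebra_simps)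
  qed
  then obtain t where t: "?h (t - 1) \<le> y" "y < ?h t"
    by blast
  have act: "active j t"
  proof (rule ccontr)
    assume "\<not> active j t"
    then have "?h t = ?h (t - 1)"
      unfolding active_def height_def using cur_other by simp
    then show False using t by simp
  qed
  define k l where "k = j div 3" and "l = t div n"
  define j' t' where "j' = j mod 3" and "t' = t mod n"
  have jt: "j = j' + 3 * k" "t = t' + n * l"
    unfolding k_def l_def j'_def t'_def by simp_all
  have "w t' = w t"
    unfolding jt w_period ..
  then have "(j', t') \<in> cells"
    using act n_pos unfolding cells_def active_def j'_def t'_def by (auto simp: mod_simps)
  moreover have "(real_of_int j' + u, y - real_of_int n * real_of_int l) \<in> closed_triangle j' t'"
  proof -
    have "height j (t - 1) u = height j' (t' - 1) u + real_of_int n * real_of_int l"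
      "height j t u = height j' t' u + real_of_int n * real_of_int l"
      using height_period[of j' "t' - 1" l u] height_period[of j' t' l u]
      unfolding jt height_column by (simp_all add: algebra_simps)
    then show ?thesis
      using t u unfolding closed_triangle_def by auto
  qed
  moreover have "z = q (real_of_int j' + u) (y - real_of_int n * real_of_int l)"
    unfolding z q_eq_iff u_def jt(1) by (intro exI[of _ k] exI[of _ l]) simp
  ultimately show "z \<in> (\<Union>(j, t)\<in>cells. cover ` closed_triangle j t)"
    by blast
qed (use range_torus_cover[of 3 "real_of_int n"] n_pos in auto)

lemma boundary_subset_graph: "slant_image j (t - 1) \<union> slant_image j t \<union> vert_image t
    \<subseteq> graph_image"
proof -
  have "path_image (edge_path e) \<subseteq> graph_image" if "e \<in> E" for e
    using that unfolding graph_image_def by blast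
  from this[OF slant_in_E] this[OF vert_in_E] show ?thesis
    unfolding path_image_edge_path_slant path_image_edge_path_vert by simp
qed

lemma closed_graph_image: "closed graph_image"
proof -
  have "finite V"
    by (simp add: V_def)
  moreover have "finite E"
    using edge_subset_V \<open>finite V\<close> by (meson finite_Pow_iff finite_subset PowI subsetI)
  moreover have "compact (path_image (edge_path e))" if "e \<in> E" for e
    using graph_embedding_columns that unfolding graph_embedding_def by (simp add: arc_imp_path
        compact_path_image)
  ultimately have "compact (\<Union>e\<in>E. path_image (edge_path e))" "compact (pos ` V)"
    by (simp_all add: compact_UN finite_imp_compact)
  then show ?thesis
    unfolding graph_image_def by (intro compact_imp_closed compact_Un)
qed

lemma open_triangle_image_homeomorphic:
  "active j t \<Longrightarrow> cover ` open_triangle j t homeomorphic ball (0::complex) 1"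
  using homeomorphic_trans[OF homeomorphic_inj_image_of_compact[OF compact_closed_triangle
      continuous_on_torus_cover inj_on_closed_triangle open_subset_closed_triangle]
      open_triangle_homeomorphic] .

text \<open>The closed triangles are the cells. Open triangles whose images meet are translates of
  each other by \<open>open_triangles_meet\<close>, hence have equal images.\<close>

lemma cells_decompose:
  "components (torus - graph_image) = (\<lambda>(j, t). cover ` open_triangle j t) ` cells"
  "(j, t) \<in> cells \<Longrightarrow> top_of_set torus frontier_of (cover ` open_triangle j t)
    = slant_image j (t - 1) \<union> slant_image j t \<union> vert_image t"
proof -
  have act: "active (fst i) (snd i)" if "i \<in> cells" for i
    using that unfolding cells_def by auto
  have fin: "finite cells"
    unfolding cells_def by (rule finite_subset[of _ "{0..<3} \<times> {0..<n}"]) auto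
  have C: "compact (cover ` closed_triangle j t)" if "active j t" for j t
    using compact_continuous_image[OF continuous_on_torus_cover compact_closed_triangle[OF that]] .
  have cl: "cover ` closed_triangle j t \<subseteq> closure (cover ` open_triangle j t)" if "active
      j t" for j t
  proof -
    have "cover ` closure (open_triangle j t) \<subseteq> closure (cover ` open_triangle j t)"
      by (rule image_closure_subset[OF continuous_on_torus_cover closed_closure closure_subset])
    then show ?thesis
      using closed_triangle_subset_closure[OF that] by blast
  qed
  have con: "connected (cover ` open_triangle j t)" if "active j t" for j t
    using homeomorphic_connectedness[OF open_triangle_image_homeomorphic[OF that]] by simp
  have ne: "cover ` open_triangle j t \<noteq> {}" if "active j t" for j t
    using homeomorphic_empty open_triangle_image_homeomorphic[OF that] by (metis ball_eq_empty
        not_one_le_zero)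
  have dis: "cover ` open_triangle j t = cover ` open_triangle j' t'"
    if meet: "cover ` open_triangle j t \<inter> cover ` open_triangle j' t' \<noteq> {}" for j t j' t'
  proof -
    obtain z z' where "z \<in> open_triangle j t" "z' \<in> open_triangle j' t'" "cover z = cover z'"
      using meet by blast
    then obtain k l where "j = j' + 3 * k" "t = t' + n * l"
      using open_triangles_meet[of "fst z" "snd z" j t "fst z'" "snd z'" j' t'] by auto
    then show ?thesis
      using open_triangle_image_period by simp
  qed
  note D = components_cell_decomposition[of cells torus "\<lambda>i. cover ` closed_triangle (fst
      i) (snd i)" graph_image
    "\<lambda>i. cover ` open_triangle (fst i) (snd i)"
    "\<lambda>i. slant_image (fst i) (snd i - 1) \<union> slant_image (fst i) (snd i) \<union>
        vert_image (snd i)",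
    OF fin _ closed_graph_image C[OF act] closed_triangle_image_eq[OF act] cl[OF act]
    boundary_subset_graph open_triangle_disjoint_graph con[OF act] ne[OF act] dis]
  show "components (torus - graph_image) = (\<lambda>(j, t). cover ` open_triangle j t) ` cells"
    using D(1) torus_covered by (simp add: case_prod_unfold)
  show "(j, t) \<in> cells \<Longrightarrow> top_of_set torus frontier_of (cover ` open_triangle j t)
    = slant_image j (t - 1) \<union> slant_image j t \<union> vert_image t"
    using D(2)[of "(j, t)"] torus_covered by (simp add: case_prod_unfold)
qed

lemma triangle_edges:
  assumes "active j t"
  shows "\<exists>u v x. distinct [u, v, x] \<and> vert t = {u, v} \<and> slant j (t - 1) = {v, x}
      \<and> slant j t = {x, u}"
proof -
  consider "w t = j mod 3" | "w t = (j + 1) mod 3"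
    using assms unfolding active_def by blast
  then show ?thesis
  proof cases
    case 1
    then have "w t \<noteq> (j + 1) mod 3"
      by presburger
    then have "vtx t \<noteq> vtx (cur (j + 1) t)" "vtx (prev t) \<noteq> vtx (cur (j + 1) t)"
      by (metis w_vtx w_cur w_prev)+
    then show ?thesis
      using 1 cur_other[OF \<open>w t \<noteq> (j + 1) mod 3\<close>] cur_self[OF 1] cur_prev[OF 1]
          vtx_prev_neq[of t]
      unfolding vert_def slant_def
      by (intro exI[of _ "vtx t"] exI[of _ "vtx (prev t)"] exI[of _ "vtx (cur (j + 1) t)"]) auto
  next
    case 2
    then have "w t \<noteq> j mod 3"
      by presburger
    then have "vtx t \<noteq> vtx (cur j t)" "vtx (prev t) \<noteq> vtx (cur j t)"
      by (metis w_vtx w_cur w_prev)+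
    then show ?thesis
      using 2 cur_other[OF \<open>w t \<noteq> j mod 3\<close>] cur_self[OF 2] cur_prev[OF 2]
          vtx_prev_neq[of t]
      unfolding vert_def slant_def
      by (intro exI[of _ "vtx t"] exI[of _ "vtx (prev t)"] exI[of _ "vtx (cur j t)"]) auto
  qed
qed

theorem triangulation_columns: "triangulation_of torus V E pos edge_path"
  unfolding triangulation_of_def
proof (intro conjI ballI simple_graph_columns graph_embedding_columns)
  fix F assume "F \<in> faces torus V E pos edge_path"
  then obtain j t where F: "F = cover ` open_triangle j t" and jt: "(j, t) \<in> cells"
    unfolding faces_def graph_image_def[symmetric] cells_decompose(1) by auto
  have act: "active j t"
    using jt unfolding cells_def by simp
  show "F homeomorphic ball (0::complex) 1"
    unfolding F by (rule open_triangle_image_homeomorphic[OF act])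
  obtain u v x where uvx: "distinct [u, v, x]" "vert t = {u, v}" "slant j (t - 1) = {v, x}" "slant
      j t = {x, u}"
    using triangle_edges[OF act] by blast
  have "top_of_set torus frontier_of F = slant_image j (t - 1) \<union> slant_image j t \<union>
      vert_image t"
    unfolding F by (rule cells_decompose(2)[OF jt])
  then have "top_of_set torus frontier_of F =
      path_image (edge_path {u, v}) \<union> path_image (edge_path {v, x}) \<union> path_image
          (edge_path {x, u})"
    unfolding uvx(2-4)[symmetric] path_image_edge_path_slant path_image_edge_path_vert by blast
  moreover have "{{u, v}, {v, x}, {x, u}} \<subseteq> E"
    unfolding uvx(2-4)[symmetric] using slant_in_E vert_in_E by blast
  ultimately show "\<exists>u v w. distinct [u, v, w] \<and> {{u, v}, {v, w}, {w, u}} \<subseteq> E \<and>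
      top_of_set torus frontier_of F =
        path_image (edge_path {u, v}) \<union> path_image (edge_path {v, w}) \<union> path_image
            (edge_path {w, u})"
    using uvx(1) by blast
qed

section \<open>The edge set, sorted by the later end of each edge\<close>

lemma slant_period: "slant (j + 3 * k) (t + n * l) = slant j t"
  using cur_column[of j k] cur_column[of "j + 1" k]
  unfolding slant_def cur_period vtx_period by (simp add: algebra_simps)

text \<open>The segment between two tops is already present when the later of its ends is placed;
  \<open>s\<close> is that end, and neither top changes between \<open>s\<close> and
  \<open>t\<close>.\<close>

lemma slant_at_birth: "\<exists>s. (w s = j mod 3 \<or> w s = (j + 1) mod 3) \<and> slant j t = slant j s"
proof (cases "cur (j + 1) t \<le> cur j t")
  case True
  define s where "s = cur j t"
  have w: "w s = j mod 3"
    unfolding s_def by (rule w_cur)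
  have "cur (j + 1) s \<le> cur (j + 1) t"
    unfolding s_def by (intro cur_mono cur_le)
  moreover have "cur (j + 1) (cur (j + 1) t) \<le> cur (j + 1) s"
    unfolding s_def by (rule cur_mono[OF True])
  ultimately have "cur (j + 1) s = cur (j + 1) t"
    using cur_self[OF w_cur] by simp
  then have "slant j t = slant j s"
    unfolding slant_def using cur_self[OF w] by (simp add: s_def)
  then show ?thesis
    using w by blast
next
  case False
  define s where "s = cur (j + 1) t"
  have w: "w s = (j + 1) mod 3"
    unfolding s_def by (rule w_cur)
  have "cur j s \<le> cur j t"
    unfolding s_def by (intro cur_mono cur_le)
  moreover have "cur j (cur j t) \<le> cur j s"
    unfolding s_def using False by (intro cur_mono) simp
  ultimately have "cur j s = cur j t"
    using cur_self[OF w_cur] by simp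
  then have "slant j t = slant j s"
    unfolding slant_def using cur_self[OF w] by (simp add: s_def)
  then show ?thesis
    using w by blast
qed

text \<open>Each vertex is listed with the three neighbours present when it appears, so that every edge is
  counted once.\<close>

lemma E_by_birth:
  "E = (\<Union>t\<in>{0..<n}. (\<lambda>p. {vtx t, vtx p}) ` {cur (w t) (t - 1), cur (w t + 1) t,
      cur (w t + 2) t})"
proof -
  have born: "(\<lambda>p. {vtx t, vtx p}) ` {cur (w t) (t - 1), cur (w t + 1) t, cur (w t + 2) t}
    = {vert t, slant (w t) t, slant (w t - 1) t}" for t
  proof -
    have "cur (w t) t = t"
      by (rule cur_self) (simp add: w_mod)
    moreover have "cur (w t + 2) t = cur (w t - 1) t"
      using cur_column[of "w t - 1" 1 t] by (simp add: add.commute)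
    ultimately have "slant (w t) t = {vtx t, vtx (cur (w t + 1) t)}"
      "slant (w t - 1) t = {vtx t, vtx (cur (w t + 2) t)}"
      unfolding slant_def by (simp_all add: insert_commute)
    then show ?thesis
      unfolding vert_def prev_def by simp
  qed
  have reduce: "\<exists>s\<in>{0..<n}. vert t = vert s \<and> slant (w t) t = slant (w s) s \<and>
      slant (w t - 1) t = slant (w s - 1) s" for t
  proof (rule bexI[of _ "t mod n"], intro conjI)
    have t: "t = t mod n + n * (t div n)"
      by simp
    show "vert t = vert (t mod n)"
      using t vert_period by metis
    have "slant j t = slant j (t mod n)" for j
      using t slant_period[of j 0 "t mod n" "t div n"] by simp
    moreover have "w t = w (t mod n)"
      using t w_period by metis
    ultimately show "slant (w t) t = slant (w (t mod n)) (t mod n)"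
      "slant (w t - 1) t = slant (w (t mod n) - 1) (t mod n)"
      by simp_all
  qed (use n_pos in simp)
  have "slant j t \<in> (\<Union>t\<in>{0..<n}. {vert t, slant (w t) t, slant (w t - 1) t})" for j t
  proof -
    obtain s where s: "w s = j mod 3 \<or> w s = (j + 1) mod 3" "slant j t = slant j s"
      using slant_at_birth by blast
    have "slant j s = slant (w s) s \<or> slant j s = slant (w s - 1) s"
      using s(1)
    proof
      assume "w s = j mod 3"
      then show ?thesis
        using slant_period[of "w s" "j div 3" s 0] by simp
    next
      assume "w s = (j + 1) mod 3"
      then have "j = (w s - 1) + 3 * ((j + 1) div 3)"
        using mod_mult_div_eq[of "j + 1" 3] by linarith
      then have "slant j s = slant ((w s - 1) + 3 * ((j + 1) div 3)) s"
        by (rule arg_cong[where f = "\<lambda>i. slant i s"])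
      also have "\<dots> = slant (w s - 1) s"
        using slant_period[of "w s - 1" "(j + 1) div 3" s 0] by simp
      finally show ?thesis ..
    qed
    moreover obtain r where "r \<in> {0..<n}" "slant (w s) s = slant (w r) r" "slant (w s - 1) s =
        slant (w r - 1) r"
      using reduce[of s] by blast
    ultimately show ?thesis
      using s(2) by auto
  qed
  moreover have "vert t \<in> (\<Union>t\<in>{0..<n}. {vert t, slant (w t) t, slant (w t - 1) t})" for t
    using reduce[of t] by blast
  moreover have "(\<Union>t\<in>{0..<n}. {vert t, slant (w t) t, slant (w t - 1) t}) \<subseteq> E"
    using slant_in_E vert_in_E by blast
  ultimately show ?thesis
    unfolding born E_def by auto
qed

end

section \<open>The family of words\<close>

text \<open>The word is 0 1 2 2 0 0 1 1 2 2 \<dots> 2. Negative values of \<open>latest0\<close> stand for vertices of the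
  preceding period.\<close>

definition letter :: "int \<Rightarrow> int" where
  "letter r = (if r \<in> {0, 4, 5} then 0 else if r \<in> {1, 6, 7} then 1 else 2)"

definition latest0 :: "int \<Rightarrow> int \<Rightarrow> int \<Rightarrow> int" where
  "latest0 n j r =
    (if j = 0 then (if r < 4 then 0 else if r = 4 then 4 else 5)
     else if j = 1 then (if r = 0 then 7 - n else if r < 6 then 1 else if r = 6 then 6 else 7)
     else (if r < 2 then -1 else if r = 2 then 2 else if r < 8 then 3 else r))"

definition word :: "int \<Rightarrow> int \<Rightarrow> int" where
  "word n t = letter (t mod n)"

definition latest :: "int \<Rightarrow> int \<Rightarrow> int \<Rightarrow> int" where
  "latest n j t = n * (t div n) + latest0 n (j mod 3) (t mod n)"

lemma latest_eval: "0 \<le> r \<Longrightarrow> r < n \<Longrightarrow> latest n j (r + n * a) = n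
    * a + latest0 n (j mod 3) r"
  and word_eval: "0 \<le> r \<Longrightarrow> r < n \<Longrightarrow> word n (r + n * a) = letter r"
  unfolding latest_def word_def by simp_all

lemma latest0_column:
  "latest0 n 0 r = (if r < 4 then 0 else if r = 4 then 4 else 5)"
  "latest0 n 1 r = (if r = 0 then 7 - n else if r < 6 then 1 else if r = 6 then 6 else 7)"
  "latest0 n 2 r = (if r < 2 then -1 else if r = 2 then 2 else if r < 8 then 3 else r)"
  by (simp_all add: latest0_def)

lemma mod3_cases: "(j::int) mod 3 = 0 \<or> j mod 3 = 1 \<or> j mod 3 = 2"
  by presburger

text \<open>Everything is checked on one period by writing \<open>t = r + n * a\<close>; the case
  \<open>r = 0\<close> is separate where the index before it belongs to the previous period. Columns
  0 and 1 hold exactly three vertices, 0, 4, 5 and 1, 6, 7, and \<open>9 \<le> n\<close> provides 2,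
  3 and 8 in column 2.\<close>

lemma column_word_word:
  assumes n: "9 \<le> n"
  shows "column_word n (word n) (latest n)"
proof
  have split: "\<exists>r a. t = r + n * a \<and> 0 \<le> r \<and> r < n" for t
    using n by (intro exI[of _ "t mod n"] exI[of _ "t div n"]) simp
  show "0 < n" using n by simp
  show "0 \<le> word n t" "word n t < 3" for t
    unfolding word_def letter_def by auto
  show "word n (t + n * k) = word n t" for t k
    unfolding word_def by simp
  show "latest n (j + 3 * k) t = latest n j t" for j k t
    unfolding latest_def by simp
  show "latest n j (t + n * k) = latest n j t + n * k" for j t k
    unfolding latest_def using n by (simp add: algebra_simps)
  show "latest n j t \<le> t" for j t
  proof -
    obtain r a where t: "t = r + n * a" "0 \<le> r" "r < n" using split by blast
    have "latest0 n (j mod 3) r \<le> r"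
      unfolding latest0_def using t n by auto
    then show ?thesis
      unfolding t(1) latest_eval[OF t(2,3)] by simp
  qed
  show "word n (latest n j t) = j mod 3" for j t
  proof -
    obtain r a where t: "t = r + n * a" "0 \<le> r" "r < n" using split by blast
    let ?s = "latest0 n (j mod 3) r"
    have "(0 \<le> ?s \<and> ?s < n \<and> letter ?s = j mod 3) \<or> (?s < 0 \<and> 0 \<le> ?s + n
        \<and> letter (?s + n) = j mod 3)"
      using mod3_cases[of j] t(2,3) n by (elim disjE) (simp_all add: latest0_column letter_def)
    then have "word n (?s + n * a) = j mod 3"
      using word_eval[of ?s n a] word_eval[of "?s + n" n "a - 1"] by (auto simp: algebra_simps)
    then show ?thesis
      unfolding t(1) latest_eval[OF t(2,3)] by (simp add: add.commute)
  qed
  show "latest n j t = (if word n t = j mod 3 then t else latest n j (t - 1))" for j t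
  proof -
    obtain r a where t: "t = r + n * a" "0 \<le> r" "r < n" using split by blast
    show ?thesis
    proof (cases "r = 0")
      case True
      have "latest n j (t - 1) = n * (a - 1) + latest0 n (j mod 3) (n - 1)"
        using latest_eval[of "n - 1" n j "a - 1"] n t True by (simp add: algebra_simps)
      then show ?thesis
        unfolding t(1) word_eval[OF t(2,3)] latest_eval[OF t(2,3)]
        using mod3_cases[of j] True n by (auto simp: latest0_def letter_def algebra_simps)
    next
      case False
      have "latest n j (t - 1) = n * a + latest0 n (j mod 3) (r - 1)"
        using latest_eval[of "r - 1" n j a] n t False by (simp add: algebra_simps)
      then show ?thesis
        unfolding t(1) word_eval[OF t(2,3)] latest_eval[OF t(2,3)]
        using mod3_cases[of j] False n t by (auto simp: latest0_def letter_def)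
    qed
  qed
  show "latest n k t' < latest n k t + n" if eq: "latest n j t = latest n j t'" for j k t t'
  proof -
    obtain r a where t: "t = r + n * a" "0 \<le> r" "r < n" using split by blast
    obtain r' a' where t': "t' = r' + n * a'" "0 \<le> r'" "r' < n" using split by blast
    define d where "d = a' - a"
    have d: "n * a' = n * a + n * d"
      unfolding d_def by (simp add: algebra_simps)
    have e: "latest0 n (j mod 3) r = latest0 n (j mod 3) r' + n * d"
      using eq d unfolding t(1) t'(1) latest_eval[OF t(2,3)] latest_eval[OF t'(2,3)] by simp
    \<comment> \<open>Within a column the values of \<open>latest0\<close> spread over at most one
      period; the extreme difference \<open>n\<close> occurs only in columns 1 and 2, between the
      start and the end of a period.\<close>
    have "\<bar>latest0 n (j mod 3) r - latest0 n (j mod 3) r'\<bar> \<le> n"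
      using mod3_cases[of j] t(2,3) t'(2,3) n by (elim disjE) (auto simp: latest0_column)
    then have "\<bar>n * d\<bar> \<le> n * 1"
      using e by simp
    then have "\<bar>d\<bar> \<le> 1"
      using n by (simp add: abs_mult)
    then consider "d = -1" | "d = 0" | "d = 1"
      by linarith
    then have "latest0 n (k mod 3) r' + n * d < latest0 n (k mod 3) r + n"
    proof cases
      case 1
      then show ?thesis
        using mod3_cases[of k] t(2,3) t'(2,3) n by (elim disjE) (simp_all add: latest0_column)
    next
      case 2
      then show ?thesis
        using e mod3_cases[of j] mod3_cases[of k] t(2,3) t'(2,3) n
        by (elim disjE) (simp_all add: latest0_column split: if_splits)
    next
      case 3
      then show ?thesis
        using e mod3_cases[of j] mod3_cases[of k] t(2,3) t'(2,3) n
        by (elim disjE) (simp_all add: latest0_column split: if_splits)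
    qed
    then show ?thesis
      using d unfolding t(1) t'(1) latest_eval[OF t(2,3)] latest_eval[OF t'(2,3)] by simp
  qed
  show "t - n < latest n (word n t) (latest n (word n t) (t - 1) - 1)" for t
  proof -
    obtain r a where t: "t = r + n * a" "0 \<le> r" "r < n" using split by blast
    have w: "word n t = letter r"
      unfolding t(1) by (rule word_eval[OF t(2,3)])
    have ev: "latest n j (s + n * a) = n * a + latest0 n (j mod 3) s" if "0 \<le> s" "s < n" for j s
      using latest_eval that .
    have ev': "latest n j (s + n * a) = n * a - n + latest0 n (j mod 3) (s + n)" if "-n \<le> s" "s
        < 0" for j s
      using latest_eval[of "s + n" n j "a - 1"] that by (simp add: algebra_simps)
    \<comment> \<open>Here \<open>c\<close> is the column of \<open>t\<close> and \<open>x\<close>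
      the offset of its predecessor there; an offset such as \<open>5 - n\<close> points into the
      preceding period.\<close>
    have fin: ?thesis if "letter r = c" "latest n c ((r - 1) + n * a) = x + n * a"
      "r - n < latest n c ((x - 1) + n * a) - n * a" for c x
    proof -
      have "t - 1 = (r - 1) + n * a" and x: "(x + n * a) - 1 = (x - 1) + n * a"
        using t(1) by simp_all
      then have "latest n (word n t) (t - 1) = x + n * a"
        using that(1,2) w by (simp only:)
      then have "latest n (word n t) (latest n (word n t) (t - 1) - 1) = latest n c ((x - 1) + n * a)"
        using that(1) w x by (simp only:)
      then show ?thesis
        using that(3) t(1) by linarith
    qed
    consider "r = 0" | "r = 1" | "r = 2" | "r = 3" | "r = 4" | "r = 5" | "r = 6" | "r = 7" | "r =
        8" | "9 \<le> r"
      using t by linarith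
    then show ?thesis
    proof cases
      case 1
      show ?thesis
        by (rule fin[of 0 "5 - n"]) (use 1 n ev'[of "-1" 0] ev'[of "4 - n" 0] in \<open>simp_all
            add: letter_def latest0_column\<close>)
    next
      case 2
      show ?thesis
        by (rule fin[of 1 "7 - n"]) (use 2 n ev[of 0 1] ev'[of "6 - n" 1] in \<open>simp_all add:
            letter_def latest0_column\<close>)
    next
      case 3
      show ?thesis
        by (rule fin[of 2 "-1"]) (use 3 n ev[of 1 2] ev'[of "-2" 2] in \<open>simp_all add:
            letter_def latest0_column\<close>)
    next
      case 4
      show ?thesis
        by (rule fin[of 2 2]) (use 4 n ev[of 2 2] ev[of 1 2] in \<open>simp_all add: letter_def
            latest0_column\<close>)
    next
      case 5
      show ?thesis
        by (rule fin[of 0 0]) (use 5 n ev[of 3 0] ev'[of "-1" 0] in \<open>simp_all add: letter_def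
            latest0_column\<close>)
    next
      case 6
      show ?thesis
        by (rule fin[of 0 4]) (use 6 n ev[of 4 0] ev[of 3 0] in \<open>simp_all add: letter_def
            latest0_column\<close>)
    next
      case 7
      show ?thesis
        by (rule fin[of 1 1]) (use 7 n ev[of 5 1] ev[of 0 1] in \<open>simp_all add: letter_def
            latest0_column\<close>)
    next
      case 8
      show ?thesis
        by (rule fin[of 1 6]) (use 8 n ev[of 6 1] ev[of 5 1] in \<open>simp_all add: letter_def
            latest0_column\<close>)
    next
      case 9
      show ?thesis
        by (rule fin[of 2 3]) (use 9 n ev[of 7 2] ev[of 2 2] in \<open>simp_all add: letter_def
            latest0_column\<close>)
    next
      case 10
      show ?thesis
        by (rule fin[of 2 "r - 1"]) (use 10 t(3) ev[of "r - 1" 2] ev[of "r - 2" 2] in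
            \<open>simp_all add: letter_def latest0_column\<close>)
    qed
  qed
qed

section \<open>The edges of the word as an explicit list\<close>

definition earlier :: "nat \<Rightarrow> nat \<Rightarrow> nat set" where
  "earlier m t =
    (if t = 0 then {5, 7, m - 1} else if t = 1 then {7, 0, m - 1} else if t = 2 then {m - 1, 0, 1}
     else if t = 3 then {2, 0, 1} else if t = 4 then {0, 1, 3} else if t = 5 then {4, 1, 3}
     else if t = 6 then {1, 5, 3} else if t = 7 then {6, 5, 3} else if t = 8 then {3, 5, 7}
     else {t - 1, 5, 7})"

lemma less_9_cases:
  fixes t :: nat
  obtains "t = 0" | "t = 1" | "t = 2" | "t = 3" | "t = 4" | "t = 5" | "t = 6" | "t = 7" | "t = 8" |
      "9 \<le> t"
  by linarith

text \<open>The neighbours in \<open>E_by_birth\<close> are reduced modulo \<open>m\<close>, so the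
  preceding period appears at the vertices 0, 1 and 2 as 5, 7 and \<open>m - 1\<close>. From 8 on
  only the third column grows, and each vertex is joined to its predecessor and to the standing tops
  5 and 7.\<close>

lemma word_edges:
  assumes m: "9 \<le> m"
  shows "column_word.E (int m) (word (int m)) (latest (int m)) = (\<lambda>(t, p). {t, p}) ` (SIGMA
      t:{..<m}. earlier m t)"
proof -
  interpret column_word "int m" "word (int m)" "latest (int m)"
    using column_word_word m by simp
  let ?n = "int m"
  have v: "vtx s = nat s" if "0 \<le> s" "s < ?n" for s
    unfolding vtx_def using that by simp
  have v': "vtx s = nat (s + ?n)" if "- ?n \<le> s" "s < 0" for s
    using v[of "s + ?n"] vtx_period[of s 1] that by simp
  have L: "latest ?n j s = latest0 ?n (j mod 3) s" if "0 \<le> s" "s < ?n" for j s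
    using latest_eval[of s ?n j 0] that by simp
  have L': "latest ?n j (-1) = latest0 ?n (j mod 3) (?n - 1) - ?n" for j
    using latest_eval[of "?n - 1" ?n j "-1"] m by simp
  have W: "word ?n (int t) = letter (int t)" if "t < m" for t
    using word_eval[of "int t" ?n 0] that by simp
  have e: "vtx ` {latest ?n (letter t) (int t - 1), latest ?n (letter t + 1) t, latest ?n (letter t + 2) t}
    = earlier m t" if t: "t < m" for t :: nat
  proof (cases t rule: less_9_cases)
    case 1
    have "latest ?n 0 (-1) = 5 - ?n" "latest ?n 1 0 = 7 - ?n" "latest ?n 2 0 = -1"
      using m by (simp_all add: L L' latest0_column)
    moreover have "vtx (5 - ?n) = 5" "vtx (7 - ?n) = 7" "vtx (-1) = m - 1"
      using m by (simp_all add: v' nat_diff_distrib)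
    ultimately show ?thesis
      using 1 unfolding earlier_def letter_def by simp
  next
    case 10
    have "latest ?n 2 (int t - 1) = int t - 1" "latest ?n 3 t = 5" "latest ?n 4 t = 7"
      using 10 t by (simp_all add: L latest0_column)
    moreover have "letter t = 2"
      using 10 by (simp add: letter_def)
    moreover have "vtx (int t - 1) = t - 1" "vtx 5 = 5" "vtx 7 = 7"
      using 10 t by (simp_all add: v nat_diff_distrib)
    ultimately show ?thesis
      using 10 unfolding earlier_def by simp
  qed (use m in \<open>auto simp: earlier_def letter_def L L' latest0_column v v' nat_diff_distrib\<close>)
  have "E = (\<Union>t\<in>{0..<?n}. (\<lambda>p. {vtx t, p}) ` vtx ` {latest ?n (word ?n t) (t -
      1), latest ?n (word ?n t + 1) t, latest ?n (word ?n t + 2) t})"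
    unfolding E_by_birth by (simp only: image_image)
  also have "{0..<?n} = int ` {..<m}"
    by (simp add: image_int_atLeastLessThan lessThan_atLeast0)
  also have "(\<Union>t\<in>int ` {..<m}. (\<lambda>p. {vtx t, p}) ` vtx ` {latest ?n (word ?n t)
      (t - 1), latest ?n (word ?n t + 1) t, latest ?n (word ?n t + 2) t})
    = (\<Union>t\<in>{..<m}. (\<lambda>p. {t, p}) ` earlier m t)"
    by (simp only: image_image UN_simps) (intro SUP_cong refl, simp add: W v flip: e)
  also have "\<dots> = (\<lambda>(t, p). {t, p}) ` (SIGMA t:{..<m}. earlier m t)"
    by auto
  finally show ?thesis .
qed

text \<open>It makes the passage from pairs \<open>(t, p)\<close> to edges injective and, for
  \<open>p = t\<close>, excludes loops; the energy then becomes a sum over \<open>3 * m\<close>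
  pairs.\<close>

lemma earlier_asym:
  assumes "9 \<le> m" "t < m" "p \<in> earlier m t"
  shows "t \<notin> earlier m p"
proof -
  have last: "0 \<notin> earlier m (m - 1)" "1 \<notin> earlier m (m - 1)" "2 \<notin> earlier m (m - 1)"
    using assms(1) unfolding earlier_def by auto
  have small: "earlier m 0 = {5, 7, m - 1}" "earlier m (Suc 0) = {7, 0, m - 1}" "earlier m 2 = {m -
      1, 0, 1}"
    "earlier m 3 = {2, 0, 1}" "earlier m 4 = {0, 1, 3}" "earlier m 5 = {4, 1, 3}" "earlier m 6 = {1, 5, 3}"
    "earlier m 7 = {6, 5, 3}" "earlier m 8 = {3, 5, 7}"
    unfolding earlier_def by simp_all
  show ?thesis
  proof (cases t rule: less_9_cases)
    case 10
    then have "p = t - 1 \<or> p = 5 \<or> p = 7"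
      using assms(3) unfolding earlier_def by auto
    moreover have "t \<notin> earlier m (t - 1)"
      using 10 unfolding earlier_def by auto
    ultimately show ?thesis
      using 10 small by auto
  qed (use assms(1,3) last in \<open>auto simp: small\<close>)
qed

section \<open>Energy and uniqueness of the groundstate\<close>

definition word_energy :: "nat \<Rightarrow> (nat \<Rightarrow> int) \<Rightarrow> int" where
  "word_energy m x =
    x 0 * (x 5 + x 7 + x (m - 1)) + x 1 * (x 7 + x 0 + x (m - 1)) + x 2 * (x (m - 1) + x 0 + x 1)
    + x 3 * (x 2 + x 0 + x 1) + x 4 * (x 0 + x 1 + x 3) + x 5 * (x 4 + x 1 + x 3)
    + x 6 * (x 1 + x 5 + x 3) + x 7 * (x 6 + x 5 + x 3) + x 8 * (x 3 + x 5 + x 7)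
    + (\<Sum>t\<in>{9..<m}. x t * (x (t - 1) + x 5 + x 7))"

lemma energy_word:
  assumes m: "9 \<le> m"
  shows "energy ((\<lambda>(t, p). {t, p}) ` (SIGMA t:{..<m}. earlier m t)) x = word_energy m x"
proof -
  let ?D = "SIGMA t:{..<m}. earlier m t"
  have ne: "t \<noteq> p" if "(t, p) \<in> ?D" for t p
    using that earlier_asym[OF m, of t p] by auto
  have "inj_on (\<lambda>(t, p). {t, p}) ?D"
  proof (rule inj_onI, clarify)
    fix t p t' p' assume a: "t < m" "p \<in> earlier m t" "t' < m" "p' \<in> earlier m t'" "{t, p}
        = {t', p'}"
    then show "t = t' \<and> p = p'"
      using earlier_asym[OF m] by (metis doubleton_eq_iff)
  qed
  then have "energy ((\<lambda>(t, p). {t, p}) ` ?D) x = (\<Sum>(t, p)\<in>?D. \<Prod>v\<in>{t, p}. x v)"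
    unfolding energy_def by (simp add: sum.reindex case_prod_unfold)
  also have "\<dots> = (\<Sum>(t, p)\<in>?D. x t * x p)"
    using ne by (intro sum.cong refl) auto
  also have "\<dots> = (\<Sum>t<m. \<Sum>p\<in>earlier m t. x t * x p)"
    by (rule sum.Sigma[symmetric]) (auto simp: earlier_def)
  also have "\<dots> = (\<Sum>t<9. \<Sum>p\<in>earlier m t. x t * x p) + (\<Sum>t\<in>{9..<m}.
      \<Sum>p\<in>earlier m t. x t * x p)"
    using m by (metis (no_types, lifting) lessThan_atLeast0 sum.atLeastLessThan_concat zero_le_numeral)
  also have "(\<Sum>t\<in>{9..<m}. \<Sum>p\<in>earlier m t. x t * x p) = (\<Sum>t\<in>{9..<m}. x t
      * (x (t - 1) + x 5 + x 7))"
  proof (intro sum.cong refl)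
    fix t assume "t \<in> {9..<m}"
    then have "earlier m t = {t - 1, 5, 7}" "t - 1 \<noteq> 5" "t - 1 \<noteq> 7"
      by (auto simp: earlier_def)
    then show "(\<Sum>p\<in>earlier m t. x t * x p) = x t * (x (t - 1) + x 5 + x 7)"
      by (simp add: algebra_simps)
  qed
  also have "(\<Sum>t<9. \<Sum>p\<in>earlier m t. x t * x p) =
    x 0 * (x 5 + x 7 + x (m - 1)) + x 1 * (x 7 + x 0 + x (m - 1)) + x 2 * (x (m - 1) + x 0 + x 1)
    + x 3 * (x 2 + x 0 + x 1) + x 4 * (x 0 + x 1 + x 3) + x 5 * (x 4 + x 1 + x 3)
    + x 6 * (x 1 + x 5 + x 3) + x 7 * (x 6 + x 5 + x 3) + x 8 * (x 3 + x 5 + x 7)"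
  proof -
    have "{..<9} = {0, 1, 2, 3, 4, 5, 6, 7, 8::nat}"
      by auto
    moreover have "m - 1 \<noteq> 5" "m - 1 \<noteq> 7" "m - 1 \<noteq> 0" "m - 1 \<noteq> 1"
      using m by auto
    ultimately show ?thesis
      by (simp add: earlier_def algebra_simps)
  qed
  finally show ?thesis
    unfolding word_energy_def by simp
qed

section \<open>The energy as a sum over faces\<close>

definition tri :: "int \<Rightarrow> int \<Rightarrow> int \<Rightarrow> int" where
  "tri a b c = a * b + b * c + a * c + 1"

text \<open>\<open>tri\<close> is the energy of a triangle shifted by its minimum -1: it is 4 on a
  monochromatic triple of spins and 0 on every other.\<close>

lemma tri_nonneg:
  assumes "a \<in> {1, -1}" "b \<in> {1, -1}" "c \<in> {1, -1}"
  shows "0 \<le> tri a b c" "tri a b c = 0 \<longleftrightarrow> \<not> (a = b \<and> b = c)"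
  using assms unfolding tri_def by auto

text \<open>Each vertex below 9 contributes the two triangles that it forms with its predecessor in
  the column and one of the other two tops. \<open>l\<close> stands for the last vertex, which is
  the top of the third column when the period starts again.\<close>

definition core_faces :: "(nat \<Rightarrow> int) \<Rightarrow> nat \<Rightarrow> int list" where
  "core_faces x l = [tri (x 0) (x 5) (x 7), tri (x 0) (x 5) (x l), tri (x 1) (x 7) (x 0), tri (x 1)
      (x 7) (x l),
    tri (x 2) (x l) (x 0), tri (x 2) (x l) (x 1), tri (x 3) (x 2) (x 0), tri (x 3) (x 2) (x 1),
    tri (x 4) (x 0) (x 1), tri (x 4) (x 0) (x 3), tri (x 5) (x 4) (x 1), tri (x 5) (x 4) (x 3),
    tri (x 6) (x 1) (x 5), tri (x 6) (x 1) (x 3), tri (x 7) (x 6) (x 5), tri (x 7) (x 6) (x 3),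
    tri (x 8) (x 3) (x 5), tri (x 8) (x 3) (x 7)]"

text \<open>The two faces at \<open>t\<close> use the edges from \<open>t\<close> and from
  \<open>t - 1\<close> to 5 and 7 once each, whereas twice the edge sum counts those from
  \<open>t\<close> twice. The discrepancies telescope to the term with
  \<open>x 8 - x (m - 1)\<close>, which the core faces compensate.\<close>

lemma path_faces_telescope:
  assumes "9 \<le> m"
  shows "(\<Sum>t\<in>{9..<m}. tri (x t) (x (t - 1)) (x 5) + tri (x t) (x (t - 1)) (x 7)) =
    2 * (\<Sum>t\<in>{9..<m}. x t * (x (t - 1) + x 5 + x 7)) + (x 8 - x (m - 1)) * (x 5 + x 7) + 2
        * (int m - 9)"
  using assms
proof (induction m rule: dec_induct)
  case (step m)
  then show ?case
    by (simp add: tri_def algebra_simps)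
qed simp

text \<open>Every edge lies in two faces, and each of the \<open>18 + 2 * (m - 9) = 2 * m\<close>
  faces adds the constant 1 from \<open>tri\<close>. On the explicit lists this is a polynomial
  identity.\<close>

lemma word_energy_faces:
  assumes "9 \<le> m"
  shows "2 * (word_energy m x + int m) = sum_list (core_faces x (m - 1))
    + (\<Sum>t\<in>{9..<m}. tri (x t) (x (t - 1)) (x 5) + tri (x t) (x (t - 1)) (x 7))"
  unfolding word_energy_def path_faces_telescope[OF assms] core_faces_def
  by (simp add: tri_def algebra_simps)

lemma word_energy_bound:
  assumes m: "9 \<le> m" and x: "\<And>t. t < m \<Longrightarrow> x t \<in> {1, -1}"
  shows "- int m \<le> word_energy m x"
    and "word_energy m x = - int m \<longleftrightarrow> set (core_faces x (m - 1)) = {0} \<and>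
      (\<forall>t\<in>{9..<m}. tri (x t) (x (t - 1)) (x 5) = 0 \<and> tri (x t) (x (t - 1)) (x 7) = 0)"
proof -
  have nn: "0 \<le> tri (x a) (x b) (x c)" if "a < m" "b < m" "c < m" for a b c
    using that x by (intro tri_nonneg(1)) auto
  have core: "\<forall>f\<in>set (core_faces x (m - 1)). 0 \<le> f"
    unfolding core_faces_def using m by (auto intro!: nn)
  have path: "0 \<le> tri (x t) (x (t - 1)) (x 5)" "0 \<le> tri (x t) (x (t - 1)) (x 7)" if "t
      \<in> {9..<m}" for t
    using that by (auto intro!: nn)
  let ?P = "\<Sum>t\<in>{9..<m}. tri (x t) (x (t - 1)) (x 5) + tri (x t) (x (t - 1)) (x 7)"
  have s: "0 \<le> sum_list (core_faces x (m - 1))" "0 \<le> ?P"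
    using core path by (auto intro!: sum_list_nonneg sum_nonneg add_nonneg_nonneg)
  moreover obtain c P where cP: "c = sum_list (core_faces x (m - 1))" "P = ?P"
    by blast
  moreover have e: "2 * (word_energy m x + int m) = c + P"
    using word_energy_faces[OF m, of x] cP by simp
  ultimately have cP0: "0 \<le> c" "0 \<le> P"
    by simp_all
  then show "- int m \<le> word_energy m x"
    using e by presburger
  have "word_energy m x = - int m \<longleftrightarrow> c = 0 \<and> P = 0"
    using e cP0 by presburger
  then have "word_energy m x = - int m \<longleftrightarrow> sum_list (core_faces x (m - 1)) = 0
      \<and> ?P = 0"
    unfolding cP .
  also have "sum_list (core_faces x (m - 1)) = 0 \<longleftrightarrow> (\<forall>f\<in>set
      (core_faces x (m - 1)). f = 0)"
    using core by (intro sum_list_nonneg_eq_0_iff) auto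
  also have "\<dots> \<longleftrightarrow> set (core_faces x (m - 1)) = {0}"
    unfolding core_faces_def by auto
  also have "?P = 0 \<longleftrightarrow> (\<forall>t\<in>{9..<m}. tri (x t) (x (t - 1)) (x 5) +
      tri (x t) (x (t - 1)) (x 7) = 0)"
    using path by (intro sum_nonneg_eq_0_iff) auto
  also have "\<dots> \<longleftrightarrow> (\<forall>t\<in>{9..<m}. tri (x t) (x (t - 1)) (x 5) = 0
      \<and> tri (x t) (x (t - 1)) (x 7) = 0)"
    using path by (intro ball_cong refl) (simp add: add_nonneg_eq_0_iff)
  finally show "word_energy m x = - int m \<longleftrightarrow> set (core_faces x (m - 1)) = {0} \<and>
      (\<forall>t\<in>{9..<m}. tri (x t) (x (t - 1)) (x 5) = 0 \<and> tri (x t) (x (t - 1)) (x 7) = 0)" .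
qed

section \<open>Rigidity of the colouring without monochromatic face\<close>

definition ground :: "nat \<Rightarrow> int" where
  "ground t = (if t \<in> {0, 1, 3, 5} then 1 else if t \<in> {2, 4, 6, 7} then -1 else if even t
      then -1 else 1)"

lemma ground_spin: "ground t \<in> {1, -1}"
  unfolding ground_def by auto

text \<open>Suppose 5 and 7 are both plus. Then 0 and 6 are minus. A plus at 4 would make 1 and 3
  minus and face 6 1 3 monochromatic; so 4 is minus, 1 and 3 are plus, \<open>l\<close> is minus, 2
  is plus, and face 3 2 1 is monochromatic. Now let 5 be plus, 7 minus and \<open>l = p8\<close>. If
  0 is plus, then \<open>l\<close> and with it 8 are minus, and 3, 1, 4, 2, 6 follow one after
  another. If 0 is minus, then 1 is plus, 6 minus, 3 plus, 8 and with it \<open>l\<close> minus, 2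
  plus, and face 3 2 1 is monochromatic again. Normalised to plus at 0, the surviving colouring is
  \<open>ground\<close> below 9.\<close>

lemma core_colouring:
  fixes p0 p1 p2 p3 p4 p5 p6 p7 p8 l :: bool
  assumes "\<not> (p0 = p5 \<and> p5 = p7)" "\<not> (p0 = p5 \<and> p5 = l)" "\<not> (p1 = p7
      \<and> p7 = p0)" "\<not> (p1 = p7 \<and> p7 = l)"
    "\<not> (p2 = l \<and> l = p0)" "\<not> (p2 = l \<and> l = p1)" "\<not> (p3 = p2 \<and> p2 =
        p0)" "\<not> (p3 = p2 \<and> p2 = p1)"
    "\<not> (p4 = p0 \<and> p0 = p1)" "\<not> (p4 = p0 \<and> p0 = p3)" "\<not> (p5 = p4 \<and> p4
        = p1)" "\<not> (p5 = p4 \<and> p4 = p3)"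
    "\<not> (p6 = p1 \<and> p1 = p5)" "\<not> (p6 = p1 \<and> p1 = p3)" "\<not> (p7 = p6 \<and> p6
        = p5)" "\<not> (p7 = p6 \<and> p6 = p3)"
    "\<not> (p8 = p3 \<and> p3 = p5)" "\<not> (p8 = p3 \<and> p3 = p7)"
  shows "p5 \<noteq> p7"
    and "l = p8 \<Longrightarrow> p1 = p0 \<and> p2 = (\<not> p0) \<and> p3 = p0 \<and> p4 =
        (\<not> p0) \<and> p5 = p0 \<and> p6 = (\<not> p0) \<and> p7 = (\<not> p0) \<and> p8 = (\<not> p0)"
  using assms by argo+

lemma core_spins:
  assumes m: "9 \<le> m" and x: "\<And>t. t < m \<Longrightarrow> x t \<in> {1, -1}" and core: "set
      (core_faces x (m - 1)) = {0}"
  shows "x 5 \<noteq> x 7"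
    and "x (m - 1) = x 8 \<Longrightarrow> t < 9 \<Longrightarrow> x t = x 0 * ground t"
proof -
  have eq: "x a = x b \<longleftrightarrow> (x a = 1) = (x b = 1)" if "a < m" "b < m" for a b
    using x[OF that(1)] x[OF that(2)] by auto
  have tri: "tri (x a) (x b) (x c) = 0 \<longleftrightarrow> \<not> ((x a = 1) = (x b = 1) \<and>
      (x b = 1) = (x c = 1))"
    if "a < m" "b < m" "c < m" for a b c
    using tri_nonneg(2)[OF x[OF that(1)] x[OF that(2)] x[OF that(3)]] eq that by simp
  have zero: "\<forall>f\<in>set (core_faces x (m - 1)). f = 0"
    using core by simp
  have faces: "\<not> ((x 0 = 1) = (x 5 = 1) \<and> (x 5 = 1) = (x 7 = 1))"
    "\<not> ((x 0 = 1) = (x 5 = 1) \<and> (x 5 = 1) = (x (m - 1) = 1))"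
    "\<not> ((x 1 = 1) = (x 7 = 1) \<and> (x 7 = 1) = (x 0 = 1))"
    "\<not> ((x 1 = 1) = (x 7 = 1) \<and> (x 7 = 1) = (x (m - 1) = 1))"
    "\<not> ((x 2 = 1) = (x (m - 1) = 1) \<and> (x (m - 1) = 1) = (x 0 = 1))"
    "\<not> ((x 2 = 1) = (x (m - 1) = 1) \<and> (x (m - 1) = 1) = (x 1 = 1))"
    "\<not> ((x 3 = 1) = (x 2 = 1) \<and> (x 2 = 1) = (x 0 = 1))"
    "\<not> ((x 3 = 1) = (x 2 = 1) \<and> (x 2 = 1) = (x 1 = 1))"
    "\<not> ((x 4 = 1) = (x 0 = 1) \<and> (x 0 = 1) = (x 1 = 1))"
    "\<not> ((x 4 = 1) = (x 0 = 1) \<and> (x 0 = 1) = (x 3 = 1))"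
    "\<not> ((x 5 = 1) = (x 4 = 1) \<and> (x 4 = 1) = (x 1 = 1))"
    "\<not> ((x 5 = 1) = (x 4 = 1) \<and> (x 4 = 1) = (x 3 = 1))"
    "\<not> ((x 6 = 1) = (x 1 = 1) \<and> (x 1 = 1) = (x 5 = 1))"
    "\<not> ((x 6 = 1) = (x 1 = 1) \<and> (x 1 = 1) = (x 3 = 1))"
    "\<not> ((x 7 = 1) = (x 6 = 1) \<and> (x 6 = 1) = (x 5 = 1))"
    "\<not> ((x 7 = 1) = (x 6 = 1) \<and> (x 6 = 1) = (x 3 = 1))"
    "\<not> ((x 8 = 1) = (x 3 = 1) \<and> (x 3 = 1) = (x 5 = 1))"
    "\<not> ((x 8 = 1) = (x 3 = 1) \<and> (x 3 = 1) = (x 7 = 1))"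
    by (rule tri[THEN iffD1]; (use m zero in \<open>simp add: core_faces_def\<close>))+
  show "x 5 \<noteq> x 7"
    using core_colouring(1)[OF faces] by auto
  assume l: "x (m - 1) = x 8" and t: "t < 9"
  have "(x (m - 1) = 1) = (x 8 = 1)"
    using l by simp
  from core_colouring(2)[OF faces this]
  have c: "(x 1 = 1) = (x 0 = 1) \<and> (x 2 = 1) = (\<not> x 0 = 1) \<and> (x 3 = 1) = (x 0 = 1)
      \<and> (x 4 = 1) = (\<not> x 0 = 1) \<and>
    (x 5 = 1) = (x 0 = 1) \<and> (x 6 = 1) = (\<not> x 0 = 1) \<and> (x 7 = 1) = (\<not> x 0 = 1)
        \<and> (x 8 = 1) = (\<not> x 0 = 1)" .
  have t1: "x t = (if x t = 1 then 1 else -1)" "x 0 = (if x 0 = 1 then 1 else -1)"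
    using x[of t] x[of 0] t m by auto
  have "x t = 1 \<longleftrightarrow> (x 0 = 1) = (ground t = 1)"
    using c t by (cases t rule: less_9_cases) (auto simp: ground_def)
  then show "x t = x 0 * ground t"
    using t1 ground_spin[of t] by (auto split: if_splits)
qed

lemma optimal_iff:
  assumes m: "9 \<le> m" "odd m" and x: "\<And>t. t < m \<Longrightarrow> x t \<in> {1, -1}"
  shows "word_energy m x = - int m \<longleftrightarrow> (\<forall>t<m. x t = x 0 * ground t)"
proof
  assume "word_energy m x = - int m"
  then have core: "set (core_faces x (m - 1)) = {0}"
    and path: "\<And>t. 9 \<le> t \<Longrightarrow> t < m \<Longrightarrow> tri (x t) (x (t - 1))
        (x 5) = 0 \<and> tri (x t) (x (t - 1)) (x 7) = 0"
    using word_energy_bound(2)[OF m(1) x] by auto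
  have ne: "x 5 \<noteq> x 7"
    by (rule core_spins(1)[OF m(1) x core])
  \<comment> \<open>Since 5 and 7 differ, a vertex with the spin of its predecessor would form a
    monochromatic face with one of them.\<close>
  have alt: "x t = - x (t - 1)" if "9 \<le> t" "t < m" for t
    using path[OF that] ne x[of t] x[of "t - 1"] x[of 5] x[of 7] that by (auto simp: tri_def)
  have tail: "8 \<le> t \<Longrightarrow> t < m \<Longrightarrow> x t = (if even t then x 8 else -
      x 8)" for t
  proof (induction t rule: dec_induct)
    case (step t)
    then show ?case
      using alt[of "Suc t"] by auto
  qed simp
  \<comment> \<open>Oddness of \<open>m\<close> enters here: \<open>m - 1\<close> and 8 are both
    even, so the core faces impose the conditions of the nine-vertex triangulation, where
    \<open>l\<close> is 8.\<close>
  have "x (m - 1) = x 8"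
    using tail[of "m - 1"] m by simp
  then have low: "x t = x 0 * ground t" if "t < 9" for t
    using core_spins(2)[OF m(1) x core] that by blast
  show "\<forall>t<m. x t = x 0 * ground t"
  proof (intro allI impI)
    fix t assume t: "t < m"
    show "x t = x 0 * ground t"
    proof (cases "t < 9")
      case False
      then show ?thesis
        using tail[of t] low[of 8] t by (simp add: ground_def)
    qed (rule low)
  qed
next
  assume g: "\<forall>t<m. x t = x 0 * ground t"
  have x0: "x 0 * x 0 = 1"
    using x[of 0] m by auto
  \<comment> \<open>A global sign cancels in every product of two spins.\<close>
  have tri: "tri (x a) (x b) (x c) = tri (ground a) (ground b) (ground c)" if "a < m" "b < m" "c <
      m" for a b c
  proof -
    have "x a * x b = (x 0 * x 0) * (ground a * ground b)" if "a < m" "b < m" for a b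
      using g that by (metis mult.assoc mult.left_commute)
    then show ?thesis
      unfolding tri_def x0 using that x0 by simp
  qed
  have last: "ground (m - 1) = -1"
  proof -
    have "ground t = -1" if "8 \<le> t" "even t" for t
      using that unfolding ground_def by auto
    then show ?thesis
      using m by simp
  qed
  have core: "set (core_faces x (m - 1)) = {0}"
    using m unfolding core_faces_def by (simp add: tri last[unfolded One_nat_def]) (simp add:
        ground_def tri_def)
  moreover have "tri (x t) (x (t - 1)) (x 5) = 0 \<and> tri (x t) (x (t - 1)) (x 7) = 0" if "t
      \<in> {9..<m}" for t
  proof -
    have "ground (t - 1) = - ground t"
      using that unfolding ground_def by auto
    then have "tri (ground t) (ground (t - 1)) (ground c) = 0" for c
      using ground_spin[of t] unfolding tri_def by auto
    then show ?thesis
      using that tri by auto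
  qed
  ultimately have zero: "set (core_faces x (m - 1)) = {0} \<and>
      (\<forall>t\<in>{9..<m}. tri (x t) (x (t - 1)) (x 5) = 0 \<and> tri (x t) (x (t - 1)) (x 7) = 0)"
    by blast
  have "word_energy m x = - int m \<longleftrightarrow> set (core_faces x (m - 1)) = {0} \<and>
      (\<forall>t\<in>{9..<m}. tri (x t) (x (t - 1)) (x 5) = 0 \<and> tri (x t) (x (t - 1)) (x 7) = 0)"
    by (rule word_energy_bound(2)[OF m(1)]) (rule x)
  from iffD2[OF this zero] show "word_energy m x = - int m" .
qed

lemma nondegenerated_word:
  assumes m: "9 \<le> m" "odd m"
  shows "nondegenerated_groundstate {..<m} ((\<lambda>(t, p). {t, p}) ` (SIGMA t:{..<m}. earlier m t))"
proof -
  let ?V = "{..<m}" and ?E = "(\<lambda>(t, p). {t, p}) ` (SIGMA t:{..<m}. earlier m t)"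
  \<comment> \<open>States are \<open>undefined\<close> outside \<open>{..<m}\<close>, so the two
    candidates are restricted in order to be states.\<close>
  define \<sigma> where "\<sigma> c = restrict (\<lambda>t. c * ground t) ?V" for c :: int
  have en: "energy ?E x = word_energy m x" for x
    by (rule energy_word[OF m(1)])
  have spin: "x t \<in> {1, -1}" if "x \<in> states ?V" "t < m" for x t
    using that unfolding states_def by (auto simp: PiE_iff)
  have \<sigma>: "\<sigma> c \<in> states ?V" "energy ?E (\<sigma> c) = - int m" if "c \<in> {1, -1}" for c
  proof -
    show s: "\<sigma> c \<in> states ?V"
    proof -
      have "c * ground t \<in> {1, -1}" for t
        using that ground_spin[of t] by auto
      then show ?thesis
        unfolding states_def \<sigma>_def by (simp add: PiE_iff)
    qed
    have "\<sigma> c 0 = c" "\<And>t. t < m \<Longrightarrow> \<sigma> c t = c * ground t"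
      using m unfolding \<sigma>_def by (simp_all add: ground_def[of 0])
    then have g: "\<forall>t<m. \<sigma> c t = \<sigma> c 0 * ground t"
      by simp
    have "word_energy m (\<sigma> c) = - int m \<longleftrightarrow> (\<forall>t<m. \<sigma> c t =
        \<sigma> c 0 * ground t)"
      by (rule optimal_iff[OF m]) (rule spin[OF s])
    from iffD2[OF this g] show "energy ?E (\<sigma> c) = - int m"
      unfolding en .
  qed
  have bound: "- int m \<le> energy ?E x" if "x \<in> states ?V" for x
    unfolding en using word_energy_bound(1)[OF m(1) spin[OF that]] .
  have "groundstates ?V ?E = {\<sigma> 1, \<sigma> (-1)}"
  proof (intro equalityI subsetI)
    fix x assume "x \<in> groundstates ?V ?E"
    then have xs: "x \<in> states ?V" and "energy ?E x \<le> energy ?E (\<sigma> 1)"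
      using \<sigma>(1)[of 1] unfolding groundstates_def by auto
    then have opt: "word_energy m x = - int m"
      unfolding en[symmetric] using \<sigma>(2)[of 1] bound[OF xs] by simp
    have "word_energy m x = - int m \<longleftrightarrow> (\<forall>t<m. x t = x 0 * ground t)"
      by (rule optimal_iff[OF m]) (rule spin[OF xs])
    from iffD1[OF this opt] have g: "t < m \<Longrightarrow> x t = x 0 * ground t" for t
      by blast
    have "x = \<sigma> (x 0)"
    proof
      fix t
      show "x t = \<sigma> (x 0) t"
        using g[of t] xs unfolding \<sigma>_def states_def by (auto simp: PiE_iff extensional_def)
    qed
    moreover have "x 0 \<in> {1, -1}"
      using spin[OF xs] m by simp
    ultimately show "x \<in> {\<sigma> 1, \<sigma> (-1)}"
      by auto
  next
    fix x assume "x \<in> {\<sigma> 1, \<sigma> (-1)}"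
    then show "x \<in> groundstates ?V ?E"
      using \<sigma>[of 1] \<sigma>[of "-1"] bound unfolding groundstates_def by auto
  qed
  moreover have "\<sigma> 1 0 \<noteq> \<sigma> (-1) 0"
    using m unfolding \<sigma>_def by (simp add: ground_def)
  then have "\<sigma> 1 \<noteq> \<sigma> (-1)"
    by metis
  ultimately show ?thesis
    unfolding nondegenerated_groundstate_def by simp
qed

theorem theorem2:
  fixes n :: nat
  assumes "n > 0"
  shows "\<exists>(V :: nat set) E \<phi> \<gamma>. triangulation_of torus V E \<phi> \<gamma>
      \<and> n \<le> card V \<and>
           nondegenerated_groundstate V E"
proof -
  \<comment> \<open>An even number of vertices is added to the nine, which keeps the number
    \<open>m - 8\<close> of path edges odd.\<close>
  define m where "m = 9 + 2 * n"
  have m: "9 \<le> m" "odd m" "n \<le> m"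
    unfolding m_def by auto
  interpret column_word "int m" "word (int m)" "latest (int m)"
    using column_word_word m(1) by simp
  have "V = {..<m}"
    unfolding V_def by simp
  then show ?thesis
    using triangulation_columns nondegenerated_word[OF m(1,2)] m(3) word_edges[OF m(1)] by (metis
        card_lessThan)
qed

end
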